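(* For $n=1,\dots,N$ let $\widetilde{\boldsymbol u}^n_{\tau,h}\in\mathbb P_2(\overline I_n;\boldsymbol V_h^{\mathrm{div}})$ and $\widetilde p^n_{\tau,h}\in\mathbb P_1(\overline I_n;Q_h)$ be the local post-processed solutions defined by (PP). Then the continuity conditions $$\partial_t\widetilde{\boldsymbol u}^n_{\tau,h}(t_n)=\partial_t\widetilde{\boldsymbol u}^{n+1}_{\tau,h}(t_n),\qquad\widetilde p^n_{\tau,h}(t_n)=\widetilde p^{n+1}_{\tau,h}(t_n)$$ hold for $n=1,\dots,N-1$.
   Context: Let $d\in\{2,3\}$, $\Omega\subset\mathbb R^d$ an open bounded domain, $T>0$, $\overline I=[0,T]$; $\langle\cdot,\cdot\rangle$ and $\|\cdot\|$ denote the inner product and norm of $L^2(\Omega)$ (scalar-, vector- or matrix-valued), $\|\cdot\|_1$ the norm of $H^1(\Omega)$. Let $\boldsymbol V=H^1_0(\Omega)^d$, $Q=\{q\in L^2(\Omega):\int_\Omega q\,dx=0\}$. Time mesh: $0=t_0<t_1<\dots<t_N=T$, $I_n=(t_{n-1},t_n]$, $\overline I_n=[t_{n-1},t_n]$, $\tau_n=t_n-t_{n-1}$. $\mathbb P_k(J;B)$ is the space of $B$-valued polynomials in $t\in J$ of degree at most $k$; $w^+$ denotes right-sided limits. $\boldsymbol V_h\subset\boldsymbol V$ and $Q_h\subset Q$ are finite-dimensional (finite element) spaces satisfying the inf-sup condition $0<\beta\le\inf_{q_h\in Q_h\setminus\{0\}}\sup_{\boldsymbol v_h\in\boldsymbol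 V_h\setminus\{0\}}\frac{-\langle\nabla\cdot\boldsymbol v_h,q_h\rangle}{\|\boldsymbol v_h\|_1\|q_h\|}$. $\boldsymbol V_h^{\mathrm{div}}=\{\boldsymbol v_h\in\boldsymbol V_h:\langle\nabla\cdot\boldsymbol v_h,q_h\rangle=0\ \forall q_h\in Q_h\}$. Operators: $\langle A_h\boldsymbol u,\boldsymbol v_h\rangle=\langle\nabla\boldsymbol u,\nabla\boldsymbol v_h\rangle$, $\langle B_h\boldsymbol v,q_h\rangle=-\langle\nabla\cdot\boldsymbol v,q_h\rangle$, $\langle B_h'q,\boldsymbol v_h\rangle=-\langle\nabla\cdot\boldsymbol v_h,q\rangle$ for $\boldsymbol u,\boldsymbol v\in\boldsymbol V$, $q\in Q$, $\boldsymbol v_h\in\boldsymbol V_h$, $q_h\in Q_h$. The force satisfies $\boldsymbol f\in C(\overline I;L^2(\Omega)^d)$. Scheme (G): let $\boldsymbol u_{\tau,h}(0)=\boldsymbol u_{0,h}\in\boldsymbol V_h^{\mathrm{div}}$ be given. Successively for $n=1,\dots,N$, $(\boldsymbol u_{\tau,h},p_{\tau,h})|_{I_n}\in\mathbb P_1(I_n;\boldsymbol V_h)\times\mathbb P_1(I_n;Q_h)$ satisfies $\boldsymbol u_{\tau,h}^+(t_{n-1})=\boldsymbol u_{\tau,h}(t_{n-1})$ and $$\int_{I_n}\langle\partial_t\boldsymbol u_{\tau,h}+A_h\boldsymbol u_{\tau,h}+B_h'p_{\tau,h},\boldsymbol v_h\rangle dt=\tfrac{\tau_n}{2}\langle\boldsymbol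 f(t_{n-1})+\boldsymbol f(t_n),\boldsymbol v_h\rangle,\qquad\int_{I_n}\langle B_h\boldsymbol u_{\tau,h},q_h\rangle dt=0$$ for all $(\boldsymbol v_h,q_h)\in\boldsymbol V_h\times Q_h$, where the degree of freedom $p^+_{\tau,h}(t_{n-1})\in Q_h$ is chosen arbitrarily. Here $\boldsymbol u_{\tau,h}(t)\in\boldsymbol V_h^{\mathrm{div}}$ for all $t$. Local post-processing (PP) on $I_n$: $\widetilde{\boldsymbol u}^n_{\tau,h}(t)=\boldsymbol u_{\tau,h}(t)+\boldsymbol c_n^{\boldsymbol u}\vartheta_n(t)$, $\widetilde p^n_{\tau,h}(t)=p_{\tau,h}(t)+d_n^p\vartheta_n'(t)$ for $t\in I_n$, with values of $\widetilde{\boldsymbol u}^n_{\tau,h}$, $\widetilde p^n_{\tau,h}$, $\partial_t\widetilde{\boldsymbol u}^n_{\tau,h}$ at $t_{n-1}$ defined as right-sided limits from $I_n$; here $\vartheta_n(t)=\alpha_n(t-t_{n-1})(t-t_n)$ with $\alpha_n\in\mathbb R$ such that $\vartheta_n'(t_{n-1})=1$, and $\boldsymbol c_n^{\boldsymbol u}\in\boldsymbol V_h^{\mathrm{div}}$, $d_n^p\in Q_h$ are chosen such that for all $(\boldsymbol v_h,q_h)\in\boldsymbol V_h\times Q_h$ $$\langle\partial_t\widetilde{\boldsymbol u}^n_{\tau,h}(t_{n-1})+A_h\widetilde{\boldsymbol u}^n_{\tau,h}(t_{n-1})+B_h'\widetilde p^n_{\tau,h}(t_{n-1}),\boldsymbol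 v_h\rangle=\langle\boldsymbol f(t_{n-1}),\boldsymbol v_h\rangle,\qquad\langle B_h\widetilde{\boldsymbol u}^n_{\tau,h}(t_{n-1}),q_h\rangle=0.$$ *)

theory Defs
  imports "HOL-Analysis.Analysis"
begin

section \<open>The Hilbert space of square integrable functions\<close>

definition sq_integrable :: "('m::euclidean_space \<Rightarrow> 'a::euclidean_space) \<Rightarrow> bool" where
  "sq_integrable f \<longleftrightarrow>
     f \<in> borel_measurable lebesgue \<and> integrable lebesgue (\<lambda>x. (norm (f x))\<^sup>2)"

definition ae_eq :: "('m::euclidean_space \<Rightarrow> 'a::euclidean_space) \<Rightarrow> ('m \<Rightarrow> 'a) \<Rightarrow> bool" where
  "ae_eq f g \<longleftrightarrow> sq_integrable f \<and> sq_integrable g \<and> (AE x in lebesgue. f x = g x)"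

lemma sq_integrable_zero: "sq_integrable (\<lambda>x. 0)"
  by (simp add: sq_integrable_def)

lemma sq_integrable_measurable: "sq_integrable f \<Longrightarrow> f \<in> borel_measurable lebesgue"
  by (simp add: sq_integrable_def)

lemma sq_integrable_scaleR:
  assumes "sq_integrable f"
  shows "sq_integrable (\<lambda>x. c *\<^sub>R f x)"
  using assms by (auto simp: sq_integrable_def power_mult_distrib)

lemma sq_integrable_uminus:
  assumes "sq_integrable f"
  shows "sq_integrable (\<lambda>x. - f x)"
  using assms by (auto simp: sq_integrable_def)

lemma sq_integrable_add:
  assumes f: "sq_integrable f" and g: "sq_integrable g"
  shows "sq_integrable (\<lambda>x. f x + g x)"
  unfolding sq_integrable_def
proof
  have [measurable]: "f \<in> borel_measurable lebesgue" "g \<in> borel_measurable lebesgue"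
    using f g by (auto simp: sq_integrable_def)
  show "(\<lambda>x. f x + g x) \<in> borel_measurable lebesgue" by measurable
  show "integrable lebesgue (\<lambda>x. (norm (f x + g x))\<^sup>2)"
  proof (rule Bochner_Integration.integrable_bound)
    show "integrable lebesgue (\<lambda>x. 2 * (norm (f x))\<^sup>2 + 2 * (norm (g x))\<^sup>2)"
      using f g by (auto simp: sq_integrable_def)
    show "(\<lambda>x. (norm (f x + g x))\<^sup>2) \<in> borel_measurable lebesgue" by measurable
    have "(norm (f x + g x))\<^sup>2 \<le> 2 * (norm (f x))\<^sup>2 + 2 * (norm (g x))\<^sup>2" for x
    proof -
      have "(norm (f x + g x))\<^sup>2 \<le> (norm (f x) + norm (g x))\<^sup>2"
        by (intro power_mono norm_triangle_ineq) auto
      also have "\<dots> \<le> 2 * (norm (f x))\<^sup>2 + 2 * (norm (g x))\<^sup>2"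
        using sum_squares_bound[of "norm (f x)" "norm (g x)"] by (simp add: power2_sum)
      finally show ?thesis .
    qed
    then show "AE x in lebesgue. norm ((norm (f x + g x))\<^sup>2)
        \<le> norm (2 * (norm (f x))\<^sup>2 + 2 * (norm (g x))\<^sup>2)" by simp
  qed
qed

lemma sq_integrable_inner:
  assumes f: "sq_integrable f" and g: "sq_integrable g"
  shows "integrable lebesgue (\<lambda>x. f x \<bullet> g x)"
proof (rule Bochner_Integration.integrable_bound)
  have [measurable]: "f \<in> borel_measurable lebesgue" "g \<in> borel_measurable lebesgue"
    using f g by (auto simp: sq_integrable_def)
  show "integrable lebesgue (\<lambda>x. (norm (f x))\<^sup>2 + (norm (g x))\<^sup>2)"
    using f g by (auto simp: sq_integrable_def)
  show "(\<lambda>x. f x \<bullet> g x) \<in> borel_measurable lebesgue" by measurable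
  have "\<bar>f x \<bullet> g x\<bar> \<le> (norm (f x))\<^sup>2 + (norm (g x))\<^sup>2" for x
  proof -
    have "\<bar>f x \<bullet> g x\<bar> \<le> norm (f x) * norm (g x)" by (rule Cauchy_Schwarz_ineq2)
    also have "\<dots> \<le> (norm (f x))\<^sup>2 + (norm (g x))\<^sup>2"
      using sum_squares_bound[of "norm (f x)" "norm (g x)"]
        mult_nonneg_nonneg[OF norm_ge_zero[of "f x"] norm_ge_zero[of "g x"]]
      by linarith
    finally show ?thesis .
  qed
  then show "AE x in lebesgue. norm (f x \<bullet> g x)
      \<le> norm ((norm (f x))\<^sup>2 + (norm (g x))\<^sup>2)" by simp
qed

quotient_type (overloaded) ('m, 'a) L2 = "'m::euclidean_space \<Rightarrow> 'a::euclidean_space" / partial: ae_eq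
proof (rule part_equivpI)
  show "\<exists>f::'m \<Rightarrow> 'a. ae_eq f f"
    using sq_integrable_zero by (auto simp: ae_eq_def)
  show "symp (ae_eq :: ('m \<Rightarrow> 'a) \<Rightarrow> _)"
    by (rule sympI) (auto simp: ae_eq_def elim: eventually_mono)
  show "transp (ae_eq :: ('m \<Rightarrow> 'a) \<Rightarrow> _)"
    by (rule transpI) (auto simp: ae_eq_def elim: eventually_elim2)
qed

instantiation L2 :: (euclidean_space, euclidean_space) real_vector
begin

lift_definition zero_L2 :: "('a, 'b) L2" is "\<lambda>x. 0"
  by (auto simp: ae_eq_def sq_integrable_zero)

lift_definition plus_L2 :: "('a, 'b) L2 \<Rightarrow> ('a, 'b) L2 \<Rightarrow> ('a, 'b) L2" is "\<lambda>f g x. f x + g x"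
  by (auto simp: ae_eq_def sq_integrable_add elim: eventually_elim2)

lift_definition scaleR_L2 :: "real \<Rightarrow> ('a, 'b) L2 \<Rightarrow> ('a, 'b) L2" is "\<lambda>c f x. c *\<^sub>R f x"
  by (auto simp: ae_eq_def sq_integrable_scaleR elim: eventually_mono)

lift_definition uminus_L2 :: "('a, 'b) L2 \<Rightarrow> ('a, 'b) L2" is "\<lambda>f x. - f x"
  by (auto simp: ae_eq_def sq_integrable_uminus elim: eventually_mono)

definition minus_L2 :: "('a, 'b) L2 \<Rightarrow> ('a, 'b) L2 \<Rightarrow> ('a, 'b) L2" where
  "minus_L2 f g = f + - g"

instance
proof
  fix f g h :: "('a, 'b) L2" and r s :: real
  show "f + g + h = f + (g + h)"
    by transfer (auto simp: ae_eq_def algebra_simps sq_integrable_add)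
  show "f + g = g + f"
    by transfer (auto simp: ae_eq_def algebra_simps sq_integrable_add)
  show "0 + f = f"
    by transfer (auto simp: ae_eq_def)
  show "- f + f = 0"
    by transfer (auto simp: ae_eq_def sq_integrable_zero)
  show "f - g = f + - g"
    by (rule minus_L2_def)
  show "r *\<^sub>R (f + g) = r *\<^sub>R f + r *\<^sub>R g"
    by transfer (simp add: ae_eq_def scaleR_add_right sq_integrable_add sq_integrable_scaleR)
  show "(r + s) *\<^sub>R f = r *\<^sub>R f + s *\<^sub>R f"
    by transfer (simp add: ae_eq_def scaleR_add_left sq_integrable_add sq_integrable_scaleR)
  show "r *\<^sub>R s *\<^sub>R f = (r * s) *\<^sub>R f"
    by transfer (simp add: ae_eq_def sq_integrable_scaleR)
  show "1 *\<^sub>R f = f"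
    by transfer (simp add: ae_eq_def)
qed

end

instantiation L2 :: (euclidean_space, euclidean_space) real_inner
begin

lift_definition inner_L2 :: "('a, 'b) L2 \<Rightarrow> ('a, 'b) L2 \<Rightarrow> real"
  is "\<lambda>f g. LINT x|lebesgue. f x \<bullet> g x"
  by (rule integral_cong_AE)
     (auto simp: ae_eq_def sq_integrable_measurable intro!: borel_measurable_inner elim: eventually_elim2)

definition norm_L2 :: "('a, 'b) L2 \<Rightarrow> real" where
  "norm_L2 f = sqrt (f \<bullet> f)"

definition sgn_L2 :: "('a, 'b) L2 \<Rightarrow> ('a, 'b) L2" where
  "sgn_L2 f = f /\<^sub>R norm f"

definition dist_L2 :: "('a, 'b) L2 \<Rightarrow> ('a, 'b) L2 \<Rightarrow> real" where
  "dist_L2 f g = norm (f - g)"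

definition uniformity_L2 :: "(('a, 'b) L2 \<times> ('a, 'b) L2) filter" where
  "uniformity_L2 = (INF e\<in>{0<..}. principal {(x, y). dist x y < e})"

definition open_L2 :: "('a, 'b) L2 set \<Rightarrow> bool" where
  "open_L2 U \<longleftrightarrow> (\<forall>x\<in>U. eventually (\<lambda>(x', y). x' = x \<longrightarrow> y \<in> U) uniformity)"

instance
proof
  fix f g h :: "('a, 'b) L2" and r s :: real and U :: "('a, 'b) L2 set"
  show "sgn f = f /\<^sub>R norm f"
    by (rule sgn_L2_def)
  show "dist f g = norm (f - g)"
    by (rule dist_L2_def)
  show "uniformity = (INF e\<in>{0<..}. principal {(x, y::('a, 'b) L2). dist x y < e})"
    by (rule uniformity_L2_def)
  show "open U \<longleftrightarrow> (\<forall>x\<in>U. eventually (\<lambda>(x', y). x' = x \<longrightarrow> y \<in> U) uniformity)"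
    by (rule open_L2_def)
  show "f \<bullet> g = g \<bullet> f"
    by transfer (simp add: inner_commute)
  show "(f + g) \<bullet> h = f \<bullet> h + g \<bullet> h"
    by transfer (simp add: inner_add_left ae_eq_def sq_integrable_inner)
  show "r *\<^sub>R f \<bullet> g = r * (f \<bullet> g)"
    by transfer simp
  show "0 \<le> f \<bullet> f"
    by transfer simp
  show "f \<bullet> f = 0 \<longleftrightarrow> f = 0"
  proof transfer
    fix f :: "'a \<Rightarrow> 'b"
    assume "ae_eq f f"
    then have f: "sq_integrable f" by (simp add: ae_eq_def)
    have "(LINT x|lebesgue. f x \<bullet> f x) = 0 \<longleftrightarrow> (AE x in lebesgue. f x \<bullet> f x = 0)"
      by (rule integral_nonneg_eq_0_iff_AE) (auto simp: sq_integrable_inner[OF f f])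
    then show "(LINT x|lebesgue. f x \<bullet> f x) = 0 \<longleftrightarrow> ae_eq f (\<lambda>x. 0)"
      by (simp add: ae_eq_def f sq_integrable_zero)
  qed
  show "norm f = sqrt (f \<bullet> f)"
    by (rule norm_L2_def)
qed

end

section \<open>Function spaces on a domain\<close>

text \<open>
  Elements of \<open>L\<^sup>2(\<Omega>)\<close> are represented by their extension by zero to the whole space, so that
  all the spaces below are subspaces of the type \<open>L2\<close> and carry its inner product and norm.
\<close>

definition L2_on :: "'m::euclidean_space set \<Rightarrow> ('m, 'a::euclidean_space) L2 set" where
  "L2_on \<Omega> = {f. AE x in lebesgue. x \<notin> \<Omega> \<longrightarrow> rep_L2 f x = 0}"

definition partial_deriv :: "'d::finite \<Rightarrow> (real^'d \<Rightarrow> real) \<Rightarrow> real^'d \<Rightarrow> real" where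
  "partial_deriv j \<phi> x = frechet_derivative \<phi> (at x) (axis j 1)"

fun C_k :: "nat \<Rightarrow> (real^'d::finite \<Rightarrow> real) \<Rightarrow> bool" where
  "C_k 0 \<phi> \<longleftrightarrow> continuous_on UNIV \<phi>"
| "C_k (Suc k) \<phi> \<longleftrightarrow> \<phi> differentiable_on UNIV \<and> (\<forall>j. C_k k (partial_deriv j \<phi>))"

definition test_functions :: "(real^'d::finite) set \<Rightarrow> (real^'d \<Rightarrow> real) set" where
  "test_functions \<Omega> = {\<phi>. (\<forall>k. C_k k \<phi>) \<and>
     compact (closure {x. \<phi> x \<noteq> 0}) \<and> closure {x. \<phi> x \<noteq> 0} \<subseteq> \<Omega>}"

definition has_weak_gradient ::
  "(real^'d::finite) set \<Rightarrow> (real^'d, real) L2 \<Rightarrow> (real^'d, real^'d) L2 \<Rightarrow> bool" where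
  "has_weak_gradient \<Omega> u g \<longleftrightarrow> g \<in> L2_on \<Omega> \<and>
     (\<forall>\<phi>\<in>test_functions \<Omega>. \<forall>j.
        (LINT x:\<Omega>|lebesgue. rep_L2 u x * partial_deriv j \<phi> x)
          = - (LINT x:\<Omega>|lebesgue. rep_L2 g x $ j * \<phi> x))"

definition H1 :: "(real^'d::finite) set \<Rightarrow> (real^'d, real) L2 set" where
  "H1 \<Omega> = {u \<in> L2_on \<Omega>. \<exists>g. has_weak_gradient \<Omega> u g}"

definition weak_gradient ::
  "(real^'d::finite) set \<Rightarrow> (real^'d, real) L2 \<Rightarrow> (real^'d, real^'d) L2" where
  "weak_gradient \<Omega> u = (THE g. has_weak_gradient \<Omega> u g)"

definition H1_norm :: "(real^'d::finite) set \<Rightarrow> (real^'d, real) L2 \<Rightarrow> real" where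
  "H1_norm \<Omega> u = sqrt ((norm u)\<^sup>2 + (norm (weak_gradient \<Omega> u))\<^sup>2)"

definition H1_0 :: "(real^'d::finite) set \<Rightarrow> (real^'d, real) L2 set" where
  "H1_0 \<Omega> = {u \<in> H1 \<Omega>. \<forall>e>0. \<exists>\<phi>\<in>test_functions \<Omega>. H1_norm \<Omega> (u - abs_L2 \<phi>) < e}"

definition component :: "'d::finite \<Rightarrow> (real^'d, real^'d) L2 \<Rightarrow> (real^'d, real) L2" where
  "component i v = abs_L2 (\<lambda>x. rep_L2 v x $ i)"

definition velocity_space :: "(real^'d::finite) set \<Rightarrow> (real^'d, real^'d) L2 set" where
  "velocity_space \<Omega> = {v. \<forall>i. component i v \<in> H1_0 \<Omega>}"

definition pressure_space :: "(real^'d::finite) set \<Rightarrow> (real^'d, real) L2 set" where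
  "pressure_space \<Omega> = {q \<in> L2_on \<Omega>. (LINT x:\<Omega>|lebesgue. rep_L2 q x) = 0}"

definition grad :: "(real^'d::finite) set \<Rightarrow> (real^'d, real^'d) L2 \<Rightarrow> (real^'d, real^'d^'d) L2" where
  "grad \<Omega> v = abs_L2 (\<lambda>x. \<chi> i j. rep_L2 (weak_gradient \<Omega> (component i v)) x $ j)"

definition divergence :: "(real^'d::finite) set \<Rightarrow> (real^'d, real^'d) L2 \<Rightarrow> (real^'d, real) L2" where
  "divergence \<Omega> v = abs_L2 (\<lambda>x. \<Sum>i\<in>UNIV. rep_L2 (weak_gradient \<Omega> (component i v)) x $ i)"

definition H1_norm_vec :: "(real^'d::finite) set \<Rightarrow> (real^'d, real^'d) L2 \<Rightarrow> real" where
  "H1_norm_vec \<Omega> v = sqrt ((norm v)\<^sup>2 + (norm (grad \<Omega> v))\<^sup>2)"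

section \<open>Discrete spaces and operators\<close>

definition fin_dim_subspace :: "'a::real_vector set \<Rightarrow> bool" where
  "fin_dim_subspace W \<longleftrightarrow> subspace W \<and> (\<exists>B. finite B \<and> span B = W)"

text \<open>
  Infimum and supremum are taken in the extended reals, so that the supremum over the empty set
  is \<open>-\<infinity>\<close> and the condition fails for \<open>V\<^sub>h = {0}\<close>, \<open>Q\<^sub>h \<noteq> {0}\<close>.
\<close>

definition inf_sup_condition ::
  "(real^'d::finite) set \<Rightarrow> real \<Rightarrow> (real^'d, real^'d) L2 set \<Rightarrow> (real^'d, real) L2 set \<Rightarrow> bool" where
  "inf_sup_condition \<Omega> \<beta> V\<^sub>h Q\<^sub>h \<longleftrightarrow> 0 < \<beta> \<and>
     ereal \<beta> \<le> (INF q\<in>Q\<^sub>h - {0}. SUP v\<in>V\<^sub>h - {0}.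
        ereal (- (divergence \<Omega> v \<bullet> q) / (H1_norm_vec \<Omega> v * norm q)))"

definition div_free ::
  "(real^'d::finite) set \<Rightarrow> (real^'d, real^'d) L2 set \<Rightarrow> (real^'d, real) L2 set
     \<Rightarrow> (real^'d, real^'d) L2 set" where
  "div_free \<Omega> V\<^sub>h Q\<^sub>h = {v \<in> V\<^sub>h. \<forall>q\<in>Q\<^sub>h. divergence \<Omega> v \<bullet> q = 0}"

text \<open>The element of \<open>W\<close> representing a linear functional on the finite-dimensional space \<open>W\<close>.\<close>

definition riesz :: "'a::real_inner set \<Rightarrow> ('a \<Rightarrow> real) \<Rightarrow> 'a" where
  "riesz W F = (THE w. w \<in> W \<and> (\<forall>v\<in>W. w \<bullet> v = F v))"

definition A_op ::
  "(real^'d::finite) set \<Rightarrow> (real^'d, real^'d) L2 set \<Rightarrow> (real^'d, real^'d) L2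
     \<Rightarrow> (real^'d, real^'d) L2" where
  "A_op \<Omega> V\<^sub>h u = riesz V\<^sub>h (\<lambda>v. grad \<Omega> u \<bullet> grad \<Omega> v)"

definition B_op ::
  "(real^'d::finite) set \<Rightarrow> (real^'d, real) L2 set \<Rightarrow> (real^'d, real^'d) L2
     \<Rightarrow> (real^'d, real) L2" where
  "B_op \<Omega> Q\<^sub>h v = riesz Q\<^sub>h (\<lambda>q. - (divergence \<Omega> v \<bullet> q))"

definition B'_op ::
  "(real^'d::finite) set \<Rightarrow> (real^'d, real^'d) L2 set \<Rightarrow> (real^'d, real) L2
     \<Rightarrow> (real^'d, real^'d) L2" where
  "B'_op \<Omega> V\<^sub>h q = riesz V\<^sub>h (\<lambda>v. - (divergence \<Omega> v \<bullet> q))"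

section \<open>Time discretization\<close>

definition time_mesh :: "real \<Rightarrow> nat \<Rightarrow> (nat \<Rightarrow> real) \<Rightarrow> bool" where
  "time_mesh T N t \<longleftrightarrow> t 0 = 0 \<and> t N = T \<and> (\<forall>n\<in>{1..N}. t (n - 1) < t n)"

definition poly_space :: "nat \<Rightarrow> real set \<Rightarrow> 'b::real_vector set \<Rightarrow> (real \<Rightarrow> 'b) set" where
  "poly_space k J B =
     {w. \<exists>a. (\<forall>i\<le>k. a i \<in> B) \<and> (\<forall>s\<in>J. w s = (\<Sum>i\<le>k. s ^ i *\<^sub>R a i))}"

text \<open>
  Time derivative on \<open>(a, b]\<close>, taken from inside the interval; its value at \<open>a\<close> is the
  right-sided limit.
\<close>

definition time_deriv :: "real \<Rightarrow> real \<Rightarrow> (real \<Rightarrow> 'b::real_normed_vector) \<Rightarrow> real \<Rightarrow> 'b" where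
  "time_deriv a b w s =
     (if s = a then Lim (at_right a) (\<lambda>r. vector_derivative w (at r within {a<..b}))
      else vector_derivative w (at s within {a<..b}))"

text \<open>
  The equations only involve the mean value of \<open>p\<close> on each subinterval, so its right-sided
  limit at \<open>t (n - 1)\<close> is a free parameter: every admissible choice of \<open>p\<close> is a solution.
\<close>

definition galerkin_solution ::
  "(real^'d::finite) set \<Rightarrow> (real^'d, real^'d) L2 set \<Rightarrow> (real^'d, real) L2 set \<Rightarrow>
   nat \<Rightarrow> (nat \<Rightarrow> real) \<Rightarrow> (real \<Rightarrow> (real^'d, real^'d) L2) \<Rightarrow> (real^'d, real^'d) L2 \<Rightarrow>
   (real \<Rightarrow> (real^'d, real^'d) L2) \<Rightarrow> (real \<Rightarrow> (real^'d, real) L2) \<Rightarrow> bool" where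
  "galerkin_solution \<Omega> V\<^sub>h Q\<^sub>h N t f u\<^sub>0 u p \<longleftrightarrow>
     u\<^sub>0 \<in> div_free \<Omega> V\<^sub>h Q\<^sub>h \<and> u 0 = u\<^sub>0 \<and>
     (\<forall>n\<in>{1..N}. let a = t (n - 1); b = t n in
        u \<in> poly_space 1 {a<..b} V\<^sub>h \<and> p \<in> poly_space 1 {a<..b} Q\<^sub>h \<and>
        (u \<longlongrightarrow> u a) (at_right a) \<and>
        (\<forall>v\<in>V\<^sub>h. integral {a<..b}
             (\<lambda>s. (time_deriv a b u s + A_op \<Omega> V\<^sub>h (u s) + B'_op \<Omega> V\<^sub>h (p s)) \<bullet> v)
           = (b - a) / 2 * ((f a + f b) \<bullet> v)) \<and>
        (\<forall>q\<in>Q\<^sub>h. integral {a<..b} (\<lambda>s. B_op \<Omega> Q\<^sub>h (u s) \<bullet> q) = 0))"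

definition theta :: "real \<Rightarrow> real \<Rightarrow> real \<Rightarrow> real \<Rightarrow> real" where
  "theta \<alpha> a b s = \<alpha> * (s - a) * (s - b)"

text \<open>Here \<open>w\<close> and \<open>r\<close> are the post-processed velocity and pressure on the interval \<open>[a, b]\<close>.\<close>

definition post_processed ::
  "(real^'d::finite) set \<Rightarrow> (real^'d, real^'d) L2 set \<Rightarrow> (real^'d, real) L2 set \<Rightarrow>
   real \<Rightarrow> real \<Rightarrow> (real \<Rightarrow> (real^'d, real^'d) L2) \<Rightarrow>
   (real \<Rightarrow> (real^'d, real^'d) L2) \<Rightarrow> (real \<Rightarrow> (real^'d, real) L2) \<Rightarrow>
   (real \<Rightarrow> (real^'d, real^'d) L2) \<Rightarrow> (real \<Rightarrow> (real^'d, real) L2) \<Rightarrow> bool" where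
  "post_processed \<Omega> V\<^sub>h Q\<^sub>h a b f u p w r \<longleftrightarrow>
     (\<exists>\<alpha>. \<exists>c\<in>div_free \<Omega> V\<^sub>h Q\<^sub>h. \<exists>d\<in>Q\<^sub>h.
        deriv (theta \<alpha> a b) a = 1 \<and>
        (\<forall>s\<in>{a<..b}. w s = u s + theta \<alpha> a b s *\<^sub>R c) \<and>
        (\<forall>s\<in>{a<..b}. r s = p s + deriv (theta \<alpha> a b) s *\<^sub>R d)) \<and>
     (w \<longlongrightarrow> w a) (at_right a) \<and> (r \<longlongrightarrow> r a) (at_right a) \<and>
     (\<forall>v\<in>V\<^sub>h. (time_deriv a b w a + A_op \<Omega> V\<^sub>h (w a) + B'_op \<Omega> V\<^sub>h (r a)) \<bullet> v = f a \<bullet> v) \<and>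
     (\<forall>q\<in>Q\<^sub>h. B_op \<Omega> Q\<^sub>h (w a) \<bullet> q = 0)"

end

theory Submission
  imports Defs
begin

text \<open>
  Write \<open>R\<^sub>n(s) = \<partial>\<^sub>t w + A w + B' r\<close> for the residual of the post-processed pair \<open>(w, r)\<close> on
  \<open>[a, b] = [t\<^sub>n\<^sub>-\<^sub>1, t\<^sub>n]\<close>, tested against \<open>V\<^sub>h\<close>. By construction \<open>R\<^sub>n(a) = f(a)\<close>; the heart of the
  matter is that also \<open>R\<^sub>n(b) = f(b)\<close>. On the subinterval the integrand of the Galerkin equation
  is affine in time, so the trapezoidal rule is exact for it, and the equation says that the endpoint
  values of the Galerkin residual add up to \<open>f(a) + f(b)\<close>. Post-processing changes these
  values by multiples \<open>\<vartheta>'(a) = 1\<close> and \<open>\<vartheta>'(b) = -1\<close> of one and the same element (\<open>\<vartheta>\<close>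
  itself vanishes at both ends), hence leaves the sum unchanged. This is
  \<open>post_processed_collocation_right\<close>.

  At a node \<open>t\<^sub>n\<close> the pairs from the left and from the right thus satisfy the same equation, and
  they have the same velocity there, namely that of the continuous Galerkin solution. Subtracting
  leaves \<open>\<langle>e, v\<rangle> = \<langle>div v, q\<rangle>\<close> for all \<open>v\<close> in \<open>V\<^sub>h\<close>, with \<open>e\<close> and \<open>q\<close> the jumps of \<open>\<partial>\<^sub>t w\<close> and \<open>r\<close>.
  As \<open>e\<close> is discretely divergence free, \<open>v = e\<close> gives \<open>e = 0\<close>, and then the inf-sup condition
  gives \<open>q = 0\<close>.

  Affine dependence on time rests on the linearity of the gradient and the divergence. As the
  weak gradient is a definite description, its linearity amounts to the uniqueness of weak
  gradients, that is, to the fundamental lemma of the calculus of variations. It is proved by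
  smooth bumps that increase to the indicator of a box: a function orthogonal to all test functions
  has vanishing integral over every small box, hence is zero almost everywhere. The discrete
  operators inherit linearity through the Riesz representation on a finite-dimensional space.
\<close>

section \<open>Smooth bump functions on boxes\<close>

lemma partial_deriv_eqI:
  assumes "(\<phi> has_derivative D) (at x)"
  shows "partial_deriv j \<phi> x = D (axis j 1)"
  unfolding partial_deriv_def using frechet_derivative_at[OF assms] by simp

text \<open>
  \<open>C_k (Suc k)\<close> asks for differentiability in place of continuity, so the spaces decrease in
  \<open>k\<close> only because differentiable functions are continuous. The product rule below uses this for the
  factor that is not differentiated.
\<close>

lemma C_k_Suc_imp: "C_k (Suc k) \<phi> \<Longrightarrow> C_k k \<phi>"
proof (induction k arbitrary: \<phi>)
  case 0
  then show ?case by (simp add: differentiable_imp_continuous_on)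
next
  case (Suc k)
  then show ?case using C_k.simps(2) by blast
qed

lemma C_k_const: "C_k k (\<lambda>x. c)"
proof (induction k arbitrary: c)
  case (Suc k)
  have "partial_deriv j (\<lambda>x. c) = (\<lambda>x. 0)" for j :: 'a
    by (rule ext, rule partial_deriv_eqI[where D="\<lambda>_. 0", simplified]) auto
  with Suc show ?case by simp
qed simp

lemma C_k_add:
  assumes "C_k k \<phi>" "C_k k \<psi>"
  shows "C_k k (\<lambda>x. \<phi> x + \<psi> x)"
  using assms
proof (induction k arbitrary: \<phi> \<psi>)
  case 0
  then show ?case by (simp add: continuous_on_add)
next
  case (Suc k)
  then have d: "\<phi> differentiable (at x)" "\<psi> differentiable (at x)" for x
    by (auto simp: differentiable_on_def)
  have "partial_deriv j (\<lambda>x. \<phi> x + \<psi> x) = (\<lambda>x. partial_deriv j \<phi> x + partial_deriv j \<psi> x)" for j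
  proof
    fix x
    show "partial_deriv j (\<lambda>x. \<phi> x + \<psi> x) x = partial_deriv j \<phi> x + partial_deriv j \<psi> x"
      using partial_deriv_eqI[OF has_derivative_add[OF d(1)[unfolded frechet_derivative_works]
          d(2)[unfolded frechet_derivative_works]]]
      by (simp add: partial_deriv_def)
  qed
  then show ?case using Suc by (simp add: differentiable_on_add)
qed

lemma C_k_mult:
  assumes "C_k k \<phi>" "C_k k \<psi>"
  shows "C_k k (\<lambda>x. \<phi> x * \<psi> x)"
  using assms
proof (induction k arbitrary: \<phi> \<psi>)
  case 0
  then show ?case by (simp add: continuous_on_mult)
next
  case (Suc k)
  then have d: "\<phi> differentiable (at x)" "\<psi> differentiable (at x)" for x
    by (auto simp: differentiable_on_def)
  have "partial_deriv j (\<lambda>x. \<phi> x * \<psi> x)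
      = (\<lambda>x. \<phi> x * partial_deriv j \<psi> x + partial_deriv j \<phi> x * \<psi> x)" for j
  proof
    fix x
    show "partial_deriv j (\<lambda>x. \<phi> x * \<psi> x) x
        = \<phi> x * partial_deriv j \<psi> x + partial_deriv j \<phi> x * \<psi> x"
      using partial_deriv_eqI[OF has_derivative_mult[OF d(1)[unfolded frechet_derivative_works]
          d(2)[unfolded frechet_derivative_works]]]
      by (simp add: partial_deriv_def)
  qed
  moreover have "C_k k \<phi>" "C_k k \<psi>" using Suc.prems by (auto intro: C_k_Suc_imp)
  moreover have "(\<lambda>x. \<phi> x * \<psi> x) differentiable_on UNIV"
    using d by (auto simp: differentiable_on_def intro: differentiable_mult)
  ultimately show ?case using Suc by (simp add: C_k_add)
qed

lemma C_k_prod: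
  assumes "finite I" "\<And>i. i \<in> I \<Longrightarrow> C_k k (\<phi> i)"
  shows "C_k k (\<lambda>x. \<Prod>i\<in>I. \<phi> i x)"
  using assms by (induction I rule: finite_induct) (auto simp: C_k_const C_k_mult)

text \<open>
  The functions \<open>exp (-1/x) / x^m\<close> on \<open>x > 0\<close>, extended by zero, span a space closed under
  differentiation. Carrying the exponent \<open>m\<close> along turns smoothness of \<open>exp (-1/x)\<close> into an induction in which only first
  derivatives are computed.
\<close>

definition flat_exp :: "nat \<Rightarrow> real \<Rightarrow> real" where
  "flat_exp m x = (if x \<le> 0 then 0 else exp (- inverse x) * inverse x ^ m)"

lemma flat_exp_over_tendsto_0: "((\<lambda>x. flat_exp m x / x) \<longlongrightarrow> 0) (at 0)"
proof -
  have "((\<lambda>x::real. inverse x ^ Suc m / exp (inverse x)) \<longlongrightarrow> 0) (at_right 0)"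
    using filterlim_compose[OF tendsto_power_div_exp_0 filterlim_inverse_at_top_right] .
  then have r: "((\<lambda>x. flat_exp m x / x) \<longlongrightarrow> 0) (at_right 0)"
  proof (rule Lim_transform_eventually)
    show "\<forall>\<^sub>F x in at_right 0. inverse x ^ Suc m / exp (inverse x) = flat_exp m x / (x::real)"
      unfolding eventually_at_filter
      by (rule always_eventually) (auto simp: flat_exp_def exp_minus field_simps)
  qed
  have "((\<lambda>x. flat_exp m x / x) \<longlongrightarrow> 0) (at_left 0)"
    by (rule Lim_transform_eventually[OF tendsto_const])
       (auto simp: eventually_at_filter flat_exp_def intro!: always_eventually)
  with r show ?thesis by (simp add: filterlim_at_split)
qed

lemma flat_exp_has_derivative:
  "(flat_exp m has_real_derivative (flat_exp (m + 2) x - of_nat m * flat_exp (m + 1) x)) (at x)"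
proof -
  consider "x < 0" | "x = 0" | "x > 0" by linarith
  then show ?thesis
  proof cases
    case 1
    then have "\<forall>\<^sub>F y in nhds x. y < 0" by (rule eventually_nhds_in_open[of "{..<0}", simplified, OF open_lessThan])
    then have ev: "\<forall>\<^sub>F y in nhds x. 0 = flat_exp m y"
      by eventually_elim (simp add: flat_exp_def)
    have "((\<lambda>_. 0::real) has_real_derivative 0) (at x)" by simp
    then have "(flat_exp m has_real_derivative 0) (at x)"
      using DERIV_cong_ev[OF refl ev refl] by blast
    with 1 show ?thesis by (simp add: flat_exp_def)
  next
    case 2
    have "(flat_exp m has_real_derivative 0) (at 0)"
      using flat_exp_over_tendsto_0[of m] by (simp add: has_field_derivative_iff flat_exp_def)
    with 2 show ?thesis by (simp add: flat_exp_def)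
  next
    case 3
    then have "\<forall>\<^sub>F y in nhds x. y > 0" by (rule eventually_nhds_in_open[of "{0<..}", simplified, OF open_greaterThan])
    then have ev: "\<forall>\<^sub>F y in nhds x. exp (- inverse y) * inverse y ^ m = flat_exp m y"
      by eventually_elim (simp add: flat_exp_def)
    have e: "((\<lambda>y. exp (- inverse y)) has_real_derivative exp (- inverse x) * (inverse x)\<^sup>2) (at x)"
      using 3 by (auto intro!: derivative_eq_intros simp: power2_eq_square)
    have i: "((\<lambda>y. inverse y ^ m) has_real_derivative - (of_nat m * inverse x ^ (m + 1))) (at x)"
    proof (cases m)
      case (Suc l)
      have "((\<lambda>y. inverse y) has_real_derivative - (inverse x)\<^sup>2) (at x)"
        using DERIV_inverse[of x] 3 by (simp add: power_inverse numeral_2_eq_2)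
      from DERIV_power[OF this, of m] show ?thesis
        by (simp add: Suc power2_eq_square algebra_simps)
    qed simp
    have "((\<lambda>y. exp (- inverse y) * inverse y ^ m) has_real_derivative
        (flat_exp (m + 2) x - of_nat m * flat_exp (m + 1) x)) (at x)"
      by (rule DERIV_cong[OF DERIV_mult[OF e i]])
         (use 3 in \<open>simp add: flat_exp_def power_add power2_eq_square algebra_simps\<close>)
    then show ?thesis using DERIV_cong_ev[OF refl ev refl] by blast
  qed
qed

text \<open>
  The slope \<open>c\<close> serves both ends of an interval: a positive one flattens to the left of \<open>a\<close>, a
  negative one to the right of \<open>a\<close>.
\<close>

lemma C_k_flat_exp: "C_k k (\<lambda>x::real^'d::finite. flat_exp m (c * (x $ i - a)))"
proof (induction k arbitrary: m)
  case 0
  have "continuous_on UNIV (flat_exp m)"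
    using flat_exp_has_derivative by (intro DERIV_continuous_on) (auto intro: DERIV_subset)
  then have "continuous_on UNIV (flat_exp m \<circ> (\<lambda>x::real^'d. c * (x $ i - a)))"
    by (intro continuous_on_compose continuous_intros) (auto elim: continuous_on_subset)
  then show ?case by (simp add: o_def)
next
  case (Suc k)
  define E where "E x = flat_exp (m + 2) (c * (x $ i - a))
    + (- of_nat m) * flat_exp (m + 1) (c * (x $ i - a))" for x :: "real^'d"
  have D: "((\<lambda>x::real^'d. flat_exp m (c * (x $ i - a))) has_derivative
      (\<lambda>h. E x * (c * h $ i))) (at x)" for x
  proof -
    have "((\<lambda>x::real^'d. c * (x $ i - a)) has_derivative (\<lambda>h. c * h $ i)) (at x)"
      by (auto intro!: derivative_eq_intros bounded_linear.has_derivative[OF bounded_linear_vec_nth])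
    from has_derivative_compose[OF this flat_exp_has_derivative[of m, unfolded has_field_derivative_def]]
    show ?thesis by (simp add: E_def)
  qed
  have "C_k k E" unfolding E_def by (intro C_k_add C_k_mult C_k_const Suc.IH)
  then have "C_k k (\<lambda>x. E x * (c * axis j 1 $ i))" for j by (intro C_k_mult C_k_const)
  moreover have "partial_deriv j (\<lambda>x. flat_exp m (c * (x $ i - a))) = (\<lambda>x. E x * (c * axis j 1 $ i))" for j
    using partial_deriv_eqI[OF D] by auto
  ultimately show ?case using D by (auto simp: differentiable_on_def differentiable_def)
qed

text \<open>
  Each coordinate contributes \<open>exp (-1/(k(x\<^sub>i - a\<^sub>i))) exp (-1/(k(b\<^sub>i - x\<^sub>i)))\<close> with \<open>k = n + 1\<close>, which is
  positive exactly on \<open>(a\<^sub>i, b\<^sub>i)\<close> and tends to 1 there as \<open>n\<close> grows.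
\<close>

definition box_bump :: "nat \<Rightarrow> real^'d::finite \<Rightarrow> real^'d \<Rightarrow> real^'d \<Rightarrow> real" where
  "box_bump n a b x = (\<Prod>i\<in>UNIV. flat_exp 0 (real (Suc n) * (x $ i - a $ i)) *
     flat_exp 0 ((- real (Suc n)) * (x $ i - b $ i)))"

lemma box_bump_eq_0: "x \<notin> box a b \<Longrightarrow> box_bump n a b x = 0"
proof -
  assume "x \<notin> box a b"
  then obtain i where "x $ i \<le> a $ i \<or> b $ i \<le> x $ i" by (auto simp: mem_box_cart not_less)
  then have "real (Suc n) * (x $ i - a $ i) \<le> 0 \<or> - real (Suc n) * (x $ i - b $ i) \<le> 0"
    by (auto simp: mult_le_0_iff)
  then have "flat_exp 0 (real (Suc n) * (x $ i - a $ i)) * flat_exp 0 (- real (Suc n) * (x $ i - b $ i)) = 0"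
    unfolding flat_exp_def by (auto simp del: of_nat_Suc)
  then show ?thesis unfolding box_bump_def by (subst prod_zero) (auto simp del: of_nat_Suc mult_eq_0_iff)
qed

lemma box_bump_bounds: "0 \<le> box_bump n a b x" "box_bump n a b x \<le> 1"
proof -
  have e: "0 \<le> flat_exp 0 x" "flat_exp 0 x \<le> 1" for x by (auto simp: flat_exp_def)
  show "0 \<le> box_bump n a b x" unfolding box_bump_def by (intro prod_nonneg ballI mult_nonneg_nonneg e)
  show "box_bump n a b x \<le> 1" unfolding box_bump_def
    by (intro prod_le_1 conjI mult_nonneg_nonneg mult_le_one e)
qed

lemma box_bump_test_function:
  assumes "cbox a b \<subseteq> \<Omega>"
  shows "box_bump n a b \<in> test_functions \<Omega>"
proof -
  have "C_k k (box_bump n a b)" for k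
    unfolding box_bump_def by (intro C_k_prod C_k_mult C_k_flat_exp) auto
  moreover have "{x. box_bump n a b x \<noteq> 0} \<subseteq> cbox a b"
    using box_bump_eq_0 box_subset_cbox by blast
  then have "closure {x. box_bump n a b x \<noteq> 0} \<subseteq> cbox a b"
    by (rule closure_minimal) (rule closed_cbox)
  moreover from this have "compact (closure {x. box_bump n a b x \<noteq> 0})"
    using compact_closure bounded_cbox bounded_subset closure_subset by (metis (no_types, lifting))
  ultimately show ?thesis using assms unfolding test_functions_def by blast
qed

lemma box_bump_tendsto_indicator:
  fixes x :: "real^'d::finite"
  shows "(\<lambda>n. box_bump n a b x) \<longlonglongrightarrow> indicator (box a b) x"
proof (cases "x \<in> box a b")
  case False
  then show ?thesis by (simp add: box_bump_eq_0)
next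
  case True
  have lim: "(\<lambda>n. flat_exp 0 (real (Suc n) * c)) \<longlonglongrightarrow> 1" if "c > 0" for c
  proof -
    have "(\<lambda>n. exp (- (inverse c * inverse (real (Suc n))))) \<longlonglongrightarrow> exp (- (inverse c * 0))"
      by (intro tendsto_intros LIMSEQ_inverse_real_of_nat)
    moreover have "flat_exp 0 (real (Suc n) * c) = exp (- (inverse c * inverse (real (Suc n))))" for n
      using that by (auto simp: flat_exp_def mult_le_0_iff)
    ultimately show ?thesis by simp
  qed
  have "(\<lambda>n. box_bump n a b x) \<longlonglongrightarrow> (\<Prod>i\<in>(UNIV::'d set). 1 * 1)"
    unfolding box_bump_def
  proof (intro tendsto_prod tendsto_mult)
    fix i
    show "(\<lambda>n. flat_exp 0 (real (Suc n) * (x $ i - a $ i))) \<longlonglongrightarrow> 1"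
      using True by (intro lim) (simp add: mem_box_cart)
    show "(\<lambda>n. flat_exp 0 (- real (Suc n) * (x $ i - b $ i))) \<longlonglongrightarrow> 1"
      using lim[of "b $ i - x $ i"] True by (simp add: mem_box_cart algebra_simps)
  qed
  with True show ?thesis by simp
qed

section \<open>The fundamental lemma of the calculus of variations\<close>

text \<open>
  Boxes form an intersection-stable generator of the Borel sets, and by countable additivity the
  sets over which \<open>f\<close> integrates to zero form a Dynkin system; the
  whole space belongs to it because boxes exhaust it.
\<close>

lemma integral_zero_on_boxes_imp_AE_zero:
  fixes f :: "'a::euclidean_space \<Rightarrow> real"
  assumes f: "integrable lborel f"
    and boxes: "\<And>a b. (LINT x:box a b|lborel. f x) = 0"
  shows "AE x in lborel. f x = 0"
proof (rule sigma_finite_measure.density_zero[OF sigma_finite_lborel f])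
  have si: "set_integrable lborel A f" if "A \<in> sets lborel" for A
    using integrable_mult_indicator[OF that f] by (simp add: set_integrable_def)
  fix A :: "'a set"
  assume "A \<in> sets lborel"
  then have A: "A \<in> sigma_sets UNIV (range (\<lambda>(a, b). box a b :: 'a set))"
    by (simp add: borel_eq_box)
  have stable: "Int_stable (range (\<lambda>(a, b). box a b :: 'a set))"
    by (auto simp: Int_stable_def box_Int_box)
  have sets: "sigma_sets UNIV (range (\<lambda>(a, b). box a b :: 'a set)) = sets lborel"
    by (simp add: borel_eq_box)
  have U: "(LINT x:UNIV|lborel. f x) = 0"
  proof -
    let ?B = "\<lambda>i::nat. box (- (real i *\<^sub>R One)) (real i *\<^sub>R One) :: 'a set"
    have "(\<lambda>i. LINT x:?B i|lborel. f x) \<longlonglongrightarrow> (LINT x:(\<Union>i. ?B i)|lborel. f x)"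
      by (rule set_integral_cont_up)
         (auto simp: incseq_def subset_box inner_add_left intro!: si)
    then show ?thesis
      unfolding UN_box_eq_UNIV boxes by (simp add: LIMSEQ_const_iff)
  qed
  have "range (\<lambda>(a, b). box a b :: 'a set) \<subseteq> Pow UNIV" by simp
  from stable this A show "(LINT x:A|lborel. f x) = 0"
  proof (induct rule: sigma_sets_induct_disjoint)
    case (compl A)
    then have A: "A \<in> sets lborel" unfolding sets by simp
    then have "(LINT x:(UNIV - A) \<union> A|lborel. f x)
        = (LINT x:UNIV - A|lborel. f x) + (LINT x:A|lborel. f x)"
      by (intro set_integral_Un si) auto
    with compl U show ?case by simp
  next
    case (union A)
    then have "range A \<subseteq> sets lborel" unfolding sets by simp
    then have "(LINT x:(\<Union>i. A i)|lborel. f x) = (\<Sum>i. (LINT x:(A i)|lborel. f x))"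
      using union(1) by (intro lebesgue_integral_countable_add si) (auto simp: disjoint_family_on_def)
    with union show ?case by simp
  qed (auto simp: boxes, simp add: set_lebesgue_integral_def)
qed

lemma sq_integrable_set_integrable_box:
  fixes g :: "real^'d::finite \<Rightarrow> real"
  assumes g: "sq_integrable g"
  shows "set_integrable lebesgue (box a b) g"
  unfolding set_integrable_def
proof (rule Bochner_Integration.integrable_bound)
  have [measurable]: "g \<in> borel_measurable lebesgue" using g by (rule sq_integrable_measurable)
  have b: "box a b \<in> sets lebesgue" by simp
  have "integrable lebesgue (indicator (box a b) :: real^'d \<Rightarrow> real)"
    by (rule integrable_real_indicator) (auto simp: emeasure_lborel_box_eq)
  moreover have "integrable lebesgue (\<lambda>x. (g x)\<^sup>2)" using g by (simp add: sq_integrable_def)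
  ultimately show "integrable lebesgue (\<lambda>x. indicator (box a b) x + (g x)\<^sup>2)" by simp
  show "(\<lambda>x. indicator (box a b) x *\<^sub>R g x) \<in> borel_measurable lebesgue"
    using b by measurable
  have "\<bar>g x\<bar> \<le> 1 + (g x)\<^sup>2" for x
    using sum_squares_bound[of 1 "\<bar>g x\<bar>"] abs_ge_zero[of "g x"] by (simp add: power2_eq_square)
  then show "AE x in lebesgue. norm (indicator (box a b) x *\<^sub>R g x) \<le> norm (indicator (box a b) x + (g x)\<^sup>2)"
    by (auto simp: indicator_def)
qed

text \<open>
  The fundamental lemma of the calculus of variations. Dominated convergence along the bumps gives
  vanishing integrals over all boxes whose closure lies in \<open>\<Omega>\<close>. Fix such a box: subboxes of it are
  of the same kind, so \<open>g\<close> vanishes almost everywhere on it, and countably many such boxes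
  cover \<open>\<Omega>\<close>.
\<close>

lemma fundamental_lemma:
  fixes g :: "real^'d::finite \<Rightarrow> real"
  assumes \<Omega>: "open \<Omega>" and g: "sq_integrable g"
    and zero: "\<And>\<phi>. \<phi> \<in> test_functions \<Omega> \<Longrightarrow> (LINT x:\<Omega>|lebesgue. g x * \<phi> x) = 0"
  shows "AE x in lebesgue. x \<in> \<Omega> \<longrightarrow> g x = 0"
proof -
  have gm [measurable]: "g \<in> borel_measurable lebesgue" using g by (rule sq_integrable_measurable)
  have box0: "(LINT x:box a b|lebesgue. g x) = 0" if ab: "cbox a b \<subseteq> \<Omega>" for a b
  proof -
    have meas: "box a b \<in> sets lebesgue" by simp
    have eq: "(LINT x:\<Omega>|lebesgue. g x * box_bump n a b x)
        = (LINT x|lebesgue. (indicator (box a b) x * g x) * box_bump n a b x)" for n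
      unfolding set_lebesgue_integral_def
    proof (rule Bochner_Integration.integral_cong[OF refl])
      fix x
      show "indicator \<Omega> x *\<^sub>R (g x * box_bump n a b x) = (indicator (box a b) x * g x) * box_bump n a b x"
        using ab box_subset_cbox[of a b] box_bump_eq_0[of x a b n] by (auto simp: indicator_def)
    qed
    have bm: "box_bump n a b \<in> borel_measurable lebesgue" for n
    proof -
      have "box_bump n a b \<in> test_functions UNIV" by (rule box_bump_test_function) simp
      then have "C_k 0 (box_bump n a b)" unfolding test_functions_def by blast
      then have "box_bump n a b \<in> borel_measurable borel"
        by (simp add: borel_measurable_continuous_onI)
      then show ?thesis by (simp add: measurable_completion)
    qed
    have "(\<lambda>n. LINT x|lebesgue. (indicator (box a b) x * g x) * box_bump n a b x)
        \<longlonglongrightarrow> (LINT x|lebesgue. (indicator (box a b) x * g x) * indicator (box a b) x)"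
    proof (rule integral_dominated_convergence[where w="\<lambda>x. norm (indicator (box a b) x *\<^sub>R g x)"])
      show "integrable lebesgue (\<lambda>x. norm (indicator (box a b) x *\<^sub>R g x))"
        using sq_integrable_set_integrable_box[OF g] unfolding set_integrable_def
        by (rule integrable_norm)
      show "AE x in lebesgue. (\<lambda>n. (indicator (box a b) x * g x) * box_bump n a b x)
          \<longlonglongrightarrow> (indicator (box a b) x * g x) * indicator (box a b) x"
        by (intro AE_I2 tendsto_mult tendsto_const box_bump_tendsto_indicator)
      show "AE x in lebesgue. norm ((indicator (box a b) x * g x) * box_bump n a b x)
          \<le> norm (indicator (box a b) x *\<^sub>R g x)" for n
        using box_bump_bounds[of n a b] by (auto simp: abs_mult intro!: mult_left_le)
    qed (use meas bm in measurable)
    then have "(LINT x|lebesgue. (indicator (box a b) x * g x) * indicator (box a b) x) = 0"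
      unfolding eq[symmetric] zero[OF box_bump_test_function[OF ab]] by (simp add: LIMSEQ_const_iff)
    moreover have "(indicator (box a b) x * g x) * indicator (box a b) x = indicator (box a b) x *\<^sub>R g x" for x
      by (simp add: indicator_def)
    ultimately show ?thesis by (simp only: set_lebesgue_integral_def)
  qed
  have loc: "AE x in lebesgue. x \<in> box a b \<longrightarrow> g x = 0" if ab: "cbox a b \<subseteq> \<Omega>" for a b
  proof -
    define F where "F x = indicator (box a b) x * g x" for x
    have Fi: "integrable lebesgue F"
      using sq_integrable_set_integrable_box[OF g, of a b] by (simp add: F_def[abs_def] set_integrable_def)
    \<comment> \<open>The argument on boxes lives on Borel sets, so \<open>F\<close> is replaced by a Borel representative.\<close>
    then obtain G where Gm: "G \<in> borel_measurable lborel" and FG: "AE x in lborel. F x = G x"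
      using completion_ex_borel_measurable_real[of F lborel] by auto
    have FG': "AE x in lebesgue. F x = G x" by (rule AE_completion[OF FG])
    have "integrable lebesgue G"
      using integrable_cong_AE[THEN iffD1, OF _ _ FG' Fi] Fi Gm by (simp add: measurable_completion)
    then have Gi: "integrable lborel G" using Gm by (simp add: integrable_completion)
    have "(LINT x:box c d|lborel. G x) = 0" for c d
    proof -
      obtain a' b' where int: "box a b \<inter> box c d = box a' b'" using box_Int_box[of a b c d] by blast
      have "(LINT x:box c d|lborel. G x) = (LINT x:box c d|lebesgue. G x)"
        using Gm unfolding set_lebesgue_integral_def by (subst integral_completion) auto
      also have "\<dots> = (LINT x:box c d|lebesgue. F x)"
        unfolding set_lebesgue_integral_def
        using Gm FG' borel_measurable_integrable[OF Fi]
        by (intro integral_cong_AE borel_measurable_scaleR borel_measurable_indicator) (auto simp: measurable_completion)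
      also have "\<dots> = (LINT x:box a' b'|lebesgue. g x)"
        unfolding set_lebesgue_integral_def F_def int[symmetric]
        by (simp add: indicator_inter_arith mult_ac)
      also have "\<dots> = 0"
      proof (cases "box a' b' = {}")
        case False
        moreover have "box a' b' \<subseteq> box a b" using int by blast
        \<comment> \<open>Nonempty open boxes determine their closures.\<close>
        ultimately have "cbox a' b' \<subseteq> cbox a b"
          using closure_mono[of "box a' b'" "box a b"] closure_box[of a' b']
            closure_minimal[OF box_subset_cbox closed_cbox, of a b] by auto
        then show ?thesis using ab by (intro box0) auto
      qed (simp add: set_lebesgue_integral_def)
      finally show ?thesis .
    qed
    then have "AE x in lborel. G x = 0" by (rule integral_zero_on_boxes_imp_AE_zero[OF Gi])
    then have "AE x in lebesgue. G x = 0" by (rule AE_completion)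
    with FG' show ?thesis by eventually_elim (auto simp: F_def)
  qed
  define I where "I = {(a, b). cbox a b \<subseteq> \<Omega>}"
  have cov: "\<Omega> \<subseteq> (\<Union>(a, b)\<in>I. box a b)"
  proof
    fix x assume "x \<in> \<Omega>"
    then obtain a b where "cbox a b \<subseteq> \<Omega>" "x \<in> box a b" using open_contains_cbox[OF \<Omega>] by metis
    then show "x \<in> (\<Union>(a, b)\<in>I. box a b)" by (auto simp: I_def)
  qed
  have "open B" if "B \<in> (\<lambda>(a, b). box a b) ` I" for B using that by (auto simp: open_box)
  then obtain F' where F': "F' \<subseteq> (\<lambda>(a, b). box a b) ` I" "countable F'"
      "\<Union>F' = \<Union>((\<lambda>(a, b). box a b) ` I)"
    by (rule Lindelof)
  have "AE x in lebesgue. x \<in> B \<longrightarrow> g x = 0" if B: "B \<in> F'" for B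
  proof -
    obtain z where "z \<in> I" "B = (\<lambda>(a, b). box a b) z" using B F'(1) by blast
    then show ?thesis using loc[of "fst z" "snd z"] by (simp add: I_def case_prod_beta)
  qed
  then have "AE x in lebesgue. \<forall>B\<in>F'. x \<in> B \<longrightarrow> g x = 0"
    by (subst AE_ball_countable[OF F'(2)]) simp
  then show ?thesis
    by eventually_elim (use cov F'(3) in blast)
qed

section \<open>Linear maps on square integrable functions\<close>

lemma sq_integrable_rep_L2: "sq_integrable (rep_L2 f)"
  using Quotient3_rep_reflp[OF Quotient3_L2, of f] by (simp add: ae_eq_def)

lemma abs_rep_L2: "abs_L2 (rep_L2 f) = f"
  by (rule Quotient3_abs_rep[OF Quotient3_L2])

lemma rep_abs_L2: "sq_integrable f \<Longrightarrow> AE x in lebesgue. rep_L2 (abs_L2 f) x = f x"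
  using rep_abs_rsp_left[OF Quotient3_L2, of f f] by (simp add: ae_eq_def)

lemma abs_L2_cong_AE:
  assumes "sq_integrable f" "sq_integrable g" "AE x in lebesgue. f x = g x"
  shows "abs_L2 f = abs_L2 g"
  using assms by (intro Quotient3_rel_abs[OF Quotient3_L2]) (simp add: ae_eq_def)

lemma L2_eqI:
  assumes "AE x in lebesgue. rep_L2 f x = rep_L2 g x"
  shows "f = g"
  using abs_L2_cong_AE[OF sq_integrable_rep_L2 sq_integrable_rep_L2 assms] by (simp add: abs_rep_L2)

lemma abs_L2_lincomb:
  assumes "sq_integrable f" "sq_integrable g"
  shows "a *\<^sub>R abs_L2 f + b *\<^sub>R abs_L2 g = abs_L2 (\<lambda>x. a *\<^sub>R f x + b *\<^sub>R g x)"
  using assms by (simp add: scaleR_L2.abs_eq plus_L2.abs_eq ae_eq_def sq_integrable_scaleR)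

lemma rep_L2_lincomb:
  "AE x in lebesgue. rep_L2 (a *\<^sub>R f + b *\<^sub>R g) x = a *\<^sub>R rep_L2 f x + b *\<^sub>R rep_L2 g x"
  using rep_abs_L2[of "\<lambda>x. a *\<^sub>R rep_L2 f x + b *\<^sub>R rep_L2 g x"]
    abs_L2_lincomb[OF sq_integrable_rep_L2[of f] sq_integrable_rep_L2[of g], of a b]
  by (simp add: abs_rep_L2 sq_integrable_add sq_integrable_scaleR sq_integrable_rep_L2)

lemma sq_integrable_bounded_linear:
  assumes L: "bounded_linear L" and f: "sq_integrable f"
  shows "sq_integrable (\<lambda>x. L (f x))"
proof -
  obtain K where K: "\<And>x. norm (L x) \<le> norm x * K" using bounded_linear.bounded[OF L] by blast
  have [measurable]: "f \<in> borel_measurable lebesgue" using f by (rule sq_integrable_measurable)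
  have "continuous_on UNIV L" using L by (rule linear_continuous_on)
  then have [measurable]: "L \<in> borel_measurable borel" by (rule borel_measurable_continuous_onI)
  have m: "(\<lambda>x. L (f x)) \<in> borel_measurable lebesgue" by measurable
  moreover have "integrable lebesgue (\<lambda>x. (norm (L (f x)))\<^sup>2)"
  proof (rule Bochner_Integration.integrable_bound)
    show "integrable lebesgue (\<lambda>x. K\<^sup>2 * (norm (f x))\<^sup>2)"
      using f by (simp add: sq_integrable_def)
    have "(norm (L (f x)))\<^sup>2 \<le> K\<^sup>2 * (norm (f x))\<^sup>2" for x
      using power_mono[OF K[of "f x"] norm_ge_zero, of 2] by (simp add: power_mult_distrib mult.commute)
    then show "AE x in lebesgue. norm ((norm (L (f x)))\<^sup>2) \<le> norm (K\<^sup>2 * (norm (f x))\<^sup>2)" by simp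
    show "(\<lambda>x. (norm (L (f x)))\<^sup>2) \<in> borel_measurable lebesgue" using m by measurable
  qed
  ultimately show ?thesis by (simp add: sq_integrable_def)
qed

lemma sq_integrable_sum:
  assumes "\<And>i. i \<in> I \<Longrightarrow> sq_integrable (f i)"
  shows "sq_integrable (\<lambda>x. \<Sum>i\<in>I. f i x)"
  using assms
  by (induction I rule: infinite_finite_induct) (auto simp: sq_integrable_zero sq_integrable_add)

text \<open>
  Gradient, divergence and component are all of this shape: a finite sum of pointwise linear maps
  applied to representatives. The representative of a linear combination agrees with the linear
  combination of representatives only almost everywhere, which is handled here once for all of
  them.
\<close>

lemma abs_L2_sum_linear_lincomb:
  assumes I: "finite I" and L: "\<And>i. bounded_linear (L i)"
  shows "abs_L2 (\<lambda>x. \<Sum>i\<in>I. L i (rep_L2 (a *\<^sub>R f i + b *\<^sub>R g i) x))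
    = a *\<^sub>R abs_L2 (\<lambda>x. \<Sum>i\<in>I. L i (rep_L2 (f i) x)) + b *\<^sub>R abs_L2 (\<lambda>x. \<Sum>i\<in>I. L i (rep_L2 (g i) x))"
proof -
  have sq: "sq_integrable (\<lambda>x. \<Sum>i\<in>I. L i (rep_L2 (h i) x))" for h
    by (rule sq_integrable_sum) (rule sq_integrable_bounded_linear[OF L sq_integrable_rep_L2])
  have "AE x in lebesgue. \<forall>i\<in>I. rep_L2 (a *\<^sub>R f i + b *\<^sub>R g i) x = a *\<^sub>R rep_L2 (f i) x + b *\<^sub>R rep_L2 (g i) x"
    by (rule AE_finite_allI[OF I rep_L2_lincomb])
  then have "AE x in lebesgue. (\<Sum>i\<in>I. L i (rep_L2 (a *\<^sub>R f i + b *\<^sub>R g i) x))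
    = a *\<^sub>R (\<Sum>i\<in>I. L i (rep_L2 (f i) x)) + b *\<^sub>R (\<Sum>i\<in>I. L i (rep_L2 (g i) x))"
  proof eventually_elim
    case (elim x)
    interpret L: bounded_linear "L i" for i by (rule L)
    show ?case using elim by (simp add: L.add L.scaleR scaleR_sum_right sum.distrib)
  qed
  then show ?thesis
    by (subst abs_L2_lincomb[OF sq sq])
       (auto intro!: abs_L2_cong_AE sq sq_integrable_add sq_integrable_scaleR)
qed

lemma component_lincomb: "component i (a *\<^sub>R u + b *\<^sub>R v) = a *\<^sub>R component i u + b *\<^sub>R component i v"
  using abs_L2_sum_linear_lincomb[of "{i}" "\<lambda>i x. x $ i" a "\<lambda>_. u" b "\<lambda>_. v"]
  by (simp add: component_def bounded_linear_vec_nth)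

section \<open>Uniqueness and linearity of the weak gradient\<close>

lemma test_function_continuous: "\<phi> \<in> test_functions \<Omega> \<Longrightarrow> continuous_on UNIV \<phi>"
  unfolding test_functions_def using C_k.simps(1) by blast

text \<open>
  This makes the left-hand side of the weak gradient identity a pairing of square integrable
  functions, hence linear in the function.
\<close>

lemma partial_deriv_test_function:
  assumes "\<phi> \<in> test_functions \<Omega>"
  shows "partial_deriv j \<phi> \<in> test_functions \<Omega>"
proof -
  let ?K = "closure {x. \<phi> x \<noteq> 0}"
  have K: "compact ?K" "?K \<subseteq> \<Omega>" and C: "\<And>k. C_k k \<phi>"
    using assms by (auto simp: test_functions_def)
  have "C_k k (partial_deriv j \<phi>)" for k using C[of "Suc k"] by simp
  moreover have "partial_deriv j \<phi> x = 0" if "x \<notin> ?K" for x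
  proof -
    have zero: "0 = \<phi> y" if "y \<in> - ?K" for y
      using closure_subset[of "{x. \<phi> x \<noteq> 0}"] that by force
    have "open (- ?K)" "x \<in> - ?K" using that by (simp_all only: open_Compl closed_closure Compl_iff not_False_eq_True)
    from has_derivative_transform_within_open[OF has_derivative_const this zero]
    have "(\<phi> has_derivative (\<lambda>_. 0)) (at x)" .
    from partial_deriv_eqI[OF this] show ?thesis by simp
  qed
  then have "closure {x. partial_deriv j \<phi> x \<noteq> 0} \<subseteq> ?K"
    by (intro closure_minimal) auto
  moreover from this have "compact (closure {x. partial_deriv j \<phi> x \<noteq> 0})"
    by (metis compact_Int_closed[OF K(1) closed_closure] Int_absorb1)
  ultimately show ?thesis using K(2) unfolding test_functions_def by blast
qed

lemma test_function_sq_integrable: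
  assumes "\<phi> \<in> test_functions \<Omega>"
  shows "sq_integrable \<phi>"
proof -
  let ?K = "closure {x. \<phi> x \<noteq> 0}"
  have K: "compact ?K" using assms by (auto simp: test_functions_def)
  have c: "continuous_on UNIV \<phi>" using assms by (rule test_function_continuous)
  then have m: "\<phi> \<in> borel_measurable lebesgue"
    by (simp add: measurable_completion borel_measurable_continuous_onI)
  have "continuous_on ?K (\<lambda>x. (\<phi> x)\<^sup>2)"
    using c by (intro continuous_on_power) (auto elim: continuous_on_subset)
  then have "integrable lborel (\<lambda>x. indicator ?K x *\<^sub>R (\<phi> x)\<^sup>2)"
    by (rule borel_integrable_compact[OF K])
  moreover have "(\<lambda>x. indicator ?K x *\<^sub>R (\<phi> x)\<^sup>2) = (\<lambda>x. (\<phi> x)\<^sup>2)"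
  proof
    fix x
    show "indicator ?K x *\<^sub>R (\<phi> x)\<^sup>2 = (\<phi> x)\<^sup>2"
      using closure_subset[of "{x. \<phi> x \<noteq> 0}"] by (cases "\<phi> x = 0") (auto simp: indicator_def)
  qed
  ultimately have i: "integrable lborel (\<lambda>x. (\<phi> x)\<^sup>2)" by simp
  then have "integrable lebesgue (\<lambda>x. (\<phi> x)\<^sup>2)" by (subst integrable_completion) auto
  with m show ?thesis by (simp add: sq_integrable_def)
qed

lemma set_integrable_mult_sq_integrable:
  fixes f g :: "'m::euclidean_space \<Rightarrow> real"
  assumes "open \<Omega>" "sq_integrable f" "sq_integrable g"
  shows "set_integrable lebesgue \<Omega> (\<lambda>x. f x * g x)"
  using assms integrable_mult_indicator[OF _ sq_integrable_inner[of f g], of \<Omega>]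
  by (simp add: set_integrable_def)

text \<open>
  On \<open>\<Omega>\<close> the fundamental lemma applies to each component of the difference; outside \<open>\<Omega>\<close> both
  gradients vanish, since elements of \<open>L2_on \<Omega>\<close> are extended by zero.
\<close>

lemma has_weak_gradient_unique:
  assumes \<Omega>: "open \<Omega>" and g: "has_weak_gradient \<Omega> u g" and h: "has_weak_gradient \<Omega> u h"
  shows "g = h"
proof -
  have sq: "sq_integrable (\<lambda>x. rep_L2 k x $ j)" for k :: "(real^'d, real^'d) L2" and j
    by (rule sq_integrable_bounded_linear[OF bounded_linear_vec_nth sq_integrable_rep_L2])
  have "AE x in lebesgue. x \<in> \<Omega> \<longrightarrow> rep_L2 g x $ j - rep_L2 h x $ j = 0" for j
  proof (rule fundamental_lemma[OF \<Omega>])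
    show "sq_integrable (\<lambda>x. rep_L2 g x $ j - rep_L2 h x $ j)"
      using sq_integrable_add[OF sq sq_integrable_uminus[OF sq]] by simp
    fix \<phi> assume \<phi>: "\<phi> \<in> test_functions \<Omega>"
    have "(LINT x:\<Omega>|lebesgue. (rep_L2 g x $ j - rep_L2 h x $ j) * \<phi> x)
      = (LINT x:\<Omega>|lebesgue. rep_L2 g x $ j * \<phi> x) - (LINT x:\<Omega>|lebesgue. rep_L2 h x $ j * \<phi> x)"
      unfolding left_diff_distrib
      by (intro set_integral_diff set_integrable_mult_sq_integrable \<Omega> sq test_function_sq_integrable[OF \<phi>])
    moreover have "(LINT x:\<Omega>|lebesgue. rep_L2 k x $ j * \<phi> x)
        = - (LINT x:\<Omega>|lebesgue. rep_L2 u x * partial_deriv j \<phi> x)" if "has_weak_gradient \<Omega> u k" for k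
      using that \<phi> by (simp add: has_weak_gradient_def)
    ultimately show "(LINT x:\<Omega>|lebesgue. (rep_L2 g x $ j - rep_L2 h x $ j) * \<phi> x) = 0"
      using g h by simp
  qed
  then have "AE x in lebesgue. \<forall>j. x \<in> \<Omega> \<longrightarrow> rep_L2 g x $ j - rep_L2 h x $ j = 0"
    by (subst AE_all_countable) auto
  moreover have "AE x in lebesgue. x \<notin> \<Omega> \<longrightarrow> rep_L2 g x = 0" "AE x in lebesgue. x \<notin> \<Omega> \<longrightarrow> rep_L2 h x = 0"
    using g h by (auto simp: has_weak_gradient_def L2_on_def)
  ultimately have "AE x in lebesgue. rep_L2 g x = rep_L2 h x"
    by eventually_elim (auto simp: vec_eq_iff)
  then show ?thesis by (rule L2_eqI)
qed

lemma weak_gradient_eqI: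
  assumes "open \<Omega>" "has_weak_gradient \<Omega> u g"
  shows "weak_gradient \<Omega> u = g"
  unfolding weak_gradient_def using assms has_weak_gradient_unique by (intro the_equality) auto

lemma set_integral_rep_L2_lincomb_mult:
  fixes L :: "'a::euclidean_space \<Rightarrow> real"
  assumes L: "bounded_linear L" and \<Omega>: "open \<Omega>" and \<phi>: "sq_integrable \<phi>"
  shows "(LINT x:\<Omega>|lebesgue. L (rep_L2 (a *\<^sub>R u + b *\<^sub>R v) x) * \<phi> x)
    = a * (LINT x:\<Omega>|lebesgue. L (rep_L2 u x) * \<phi> x) + b * (LINT x:\<Omega>|lebesgue. L (rep_L2 v x) * \<phi> x)"
proof -
  interpret L: bounded_linear L by (rule L)
  have sq: "sq_integrable (\<lambda>x. L (rep_L2 w x))" for w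
    by (rule sq_integrable_bounded_linear[OF L sq_integrable_rep_L2])
  have int: "set_integrable lebesgue \<Omega> (\<lambda>x. L (rep_L2 w x) * \<phi> x)" for w
    by (intro set_integrable_mult_sq_integrable \<Omega> sq \<phi>)
  have [measurable]: "(\<lambda>x. L (rep_L2 w x)) \<in> borel_measurable lebesgue" "\<phi> \<in> borel_measurable lebesgue"
      "\<Omega> \<in> sets lebesgue" for w
    using sq \<phi> \<Omega> by (auto intro: sq_integrable_measurable)
  have "(LINT x:\<Omega>|lebesgue. L (rep_L2 (a *\<^sub>R u + b *\<^sub>R v) x) * \<phi> x)
    = (LINT x:\<Omega>|lebesgue. a * (L (rep_L2 u x) * \<phi> x) + b * (L (rep_L2 v x) * \<phi> x))"
    unfolding set_lebesgue_integral_def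
  proof (rule integral_cong_AE)
    show "AE x in lebesgue. indicator \<Omega> x *\<^sub>R (L (rep_L2 (a *\<^sub>R u + b *\<^sub>R v) x) * \<phi> x)
       = indicator \<Omega> x *\<^sub>R (a * (L (rep_L2 u x) * \<phi> x) + b * (L (rep_L2 v x) * \<phi> x))"
      using rep_L2_lincomb[of a u b v]
      by eventually_elim (simp add: L.add L.scaleR algebra_simps)
  qed measurable
  also have "\<dots> = a * (LINT x:\<Omega>|lebesgue. L (rep_L2 u x) * \<phi> x) + b * (LINT x:\<Omega>|lebesgue. L (rep_L2 v x) * \<phi> x)"
    using int by (subst set_integral_add) auto
  finally show ?thesis .
qed

lemma weak_gradient_lincomb:
  assumes \<Omega>: "open \<Omega>" and u: "u \<in> H1 \<Omega>" and v: "v \<in> H1 \<Omega>"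
  shows "weak_gradient \<Omega> (a *\<^sub>R u + b *\<^sub>R v) = a *\<^sub>R weak_gradient \<Omega> u + b *\<^sub>R weak_gradient \<Omega> v"
proof -
  obtain g h where g: "has_weak_gradient \<Omega> u g" and h: "has_weak_gradient \<Omega> v h"
    using u v by (auto simp: H1_def)
  have "has_weak_gradient \<Omega> (a *\<^sub>R u + b *\<^sub>R v) (a *\<^sub>R g + b *\<^sub>R h)"
    unfolding has_weak_gradient_def
  proof (intro conjI ballI allI)
    have "AE x in lebesgue. x \<notin> \<Omega> \<longrightarrow> rep_L2 g x = 0" "AE x in lebesgue. x \<notin> \<Omega> \<longrightarrow> rep_L2 h x = 0"
      using g h by (auto simp: has_weak_gradient_def L2_on_def)
    with rep_L2_lincomb[of a g b h]
    have "AE x in lebesgue. x \<notin> \<Omega> \<longrightarrow> rep_L2 (a *\<^sub>R g + b *\<^sub>R h) x = 0"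
      by eventually_elim simp
    then show "a *\<^sub>R g + b *\<^sub>R h \<in> L2_on \<Omega>" by (simp add: L2_on_def)
    fix \<phi> j assume \<phi>: "\<phi> \<in> test_functions \<Omega>"
    note sq = test_function_sq_integrable[OF \<phi>]
      test_function_sq_integrable[OF partial_deriv_test_function[OF \<phi>]]
    show "(LINT x:\<Omega>|lebesgue. rep_L2 (a *\<^sub>R u + b *\<^sub>R v) x * partial_deriv j \<phi> x)
        = - (LINT x:\<Omega>|lebesgue. rep_L2 (a *\<^sub>R g + b *\<^sub>R h) x $ j * \<phi> x)"
      using set_integral_rep_L2_lincomb_mult[OF bounded_linear_ident \<Omega> sq(2), of a u b v]
        set_integral_rep_L2_lincomb_mult[OF bounded_linear_vec_nth \<Omega> sq(1), of a g b h]
        g h \<phi> by (simp add: has_weak_gradient_def)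
  qed
  with g h show ?thesis using weak_gradient_eqI[OF \<Omega>] by metis
qed

lemma velocity_component_H1: "v \<in> velocity_space \<Omega> \<Longrightarrow> component i v \<in> H1 \<Omega>"
  by (auto simp: velocity_space_def H1_0_def)

lemma grad_lincomb:
  fixes \<Omega> :: "(real^'d::finite) set"
  assumes "open \<Omega>" "u \<in> velocity_space \<Omega>" "v \<in> velocity_space \<Omega>"
  shows "grad \<Omega> (a *\<^sub>R u + b *\<^sub>R v) = a *\<^sub>R grad \<Omega> u + b *\<^sub>R grad \<Omega> v"
proof -
  have L: "bounded_linear (axis i :: real^'d \<Rightarrow> real^'d^'d)" for i
    by (auto simp: axis_def vec_eq_iff intro!: linear_conv_bounded_linear[THEN iffD1] linearI)
  have eq: "grad \<Omega> w = abs_L2 (\<lambda>x. \<Sum>i\<in>UNIV. axis i (rep_L2 (weak_gradient \<Omega> (component i w)) x))" for w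
    unfolding grad_def
    by (intro arg_cong[of _ _ abs_L2] ext) (simp add: vec_eq_iff axis_def if_distrib[of "\<lambda>x. x $ _"] cong: if_cong)
  show ?thesis
    unfolding eq component_lincomb weak_gradient_lincomb[OF assms(1) velocity_component_H1 velocity_component_H1, OF assms(2,3)]
    by (rule abs_L2_sum_linear_lincomb) (auto intro: L)
qed

lemma divergence_lincomb:
  fixes \<Omega> :: "(real^'d::finite) set"
  assumes "open \<Omega>" "u \<in> velocity_space \<Omega>" "v \<in> velocity_space \<Omega>"
  shows "divergence \<Omega> (a *\<^sub>R u + b *\<^sub>R v) = a *\<^sub>R divergence \<Omega> u + b *\<^sub>R divergence \<Omega> v"
  unfolding divergence_def component_lincomb
    weak_gradient_lincomb[OF assms(1) velocity_component_H1 velocity_component_H1, OF assms(2,3)]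
  by (rule abs_L2_sum_linear_lincomb) (auto intro: bounded_linear_vec_nth)

section \<open>The discrete operators\<close>

text \<open>
  The ambient inner product space need not be complete or finite-dimensional, so the representing
  element is built by adjoining one spanning vector at a time, after making it orthogonal to the
  previous ones. The orthogonal projection needed for this is itself an instance of the
  representation on the smaller span.
\<close>

lemma riesz_representation_span:
  fixes F :: "'a::real_inner \<Rightarrow> real"
  assumes "finite B"
    and "\<And>u v a b. u \<in> span B \<Longrightarrow> v \<in> span B \<Longrightarrow> F (a *\<^sub>R u + b *\<^sub>R v) = a * F u + b * F v"
  shows "\<exists>w\<in>span B. \<forall>v\<in>span B. w \<bullet> v = F v"
  using assms
proof (induction B arbitrary: F rule: finite_induct)
  case empty
  have "F 0 = 0" using empty[of 0 0 0 0] by simp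
  then show ?case by simp
next
  case (insert b B)
  have sub: "span B \<subseteq> span (insert b B)" by (intro span_mono) auto
  obtain p where p: "p \<in> span B" "\<forall>v\<in>span B. p \<bullet> v = b \<bullet> v"
    using insert.IH[of "\<lambda>v. b \<bullet> v"] by (auto simp: inner_add_right)
  obtain w where w: "w \<in> span B" "\<forall>v\<in>span B. w \<bullet> v = F v"
    using insert.IH[of F] insert.prems sub by blast
  define e where "e = b - p"
  have orth: "e \<bullet> v = 0" "v \<bullet> e = 0" if "v \<in> span B" for v
    using p(2) that by (auto simp: e_def inner_diff_left inner_diff_right inner_commute)
  have e: "e \<in> span (insert b B)" unfolding e_def
    using p(1) sub by (intro span_diff) (auto intro: span_base)
  have dec: "\<exists>c. \<exists>z\<in>span B. v = z + c *\<^sub>R e" if "v \<in> span (insert b B)" for v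
  proof -
    obtain c where c: "v - c *\<^sub>R b \<in> span B" using \<open>v \<in> span (insert b B)\<close> by (auto simp: span_insert)
    have "v = (v - c *\<^sub>R b + c *\<^sub>R p) + c *\<^sub>R e" by (simp add: e_def algebra_simps)
    moreover have "v - c *\<^sub>R b + c *\<^sub>R p \<in> span B" using c p(1) by (intro span_add span_scale)
    ultimately show ?thesis by blast
  qed
  \<comment> \<open>If \<open>e = 0\<close>, the quotient is 0 by convention and the correction vanishes, as it should.\<close>
  define W where "W = w + (F e / (e \<bullet> e)) *\<^sub>R e"
  have "W \<bullet> v = F v" if v: "v \<in> span (insert b B)" for v
  proof -
    obtain c z where z: "z \<in> span B" "v = z + c *\<^sub>R e" using dec[OF v] by blast
    have F0: "F 0 = 0" using insert.prems[of 0 0 0 0] by (simp add: span_zero)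
    have "F v = F z + c * F e" using insert.prems[of z e 1 c] z sub e by auto
    moreover have "W \<bullet> v = F z + c * (F e / (e \<bullet> e)) * (e \<bullet> e)"
      using z w orth by (simp add: W_def inner_add_left inner_add_right)
    ultimately show ?thesis using F0 by (cases "e = 0") auto
  qed
  moreover have "W \<in> span (insert b B)" unfolding W_def
    using w(1) sub e by (intro span_add span_scale) auto
  ultimately show ?case by blast
qed

lemma riesz_inner:
  assumes W: "fin_dim_subspace W"
    and F: "\<And>u v a b. u \<in> W \<Longrightarrow> v \<in> W \<Longrightarrow> F (a *\<^sub>R u + b *\<^sub>R v) = a * F u + b * F v"
    and v: "v \<in> W"
  shows "riesz W F \<bullet> v = F v"
proof -
  obtain B where B: "finite B" "span B = W" and sub: "subspace W"
    using W by (auto simp: fin_dim_subspace_def)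
  have ex: "\<exists>w. w \<in> W \<and> (\<forall>v\<in>W. w \<bullet> v = F v)"
    using riesz_representation_span[OF B(1), of F] F B(2) by blast
  moreover have "w = w'" if "w \<in> W \<and> (\<forall>v\<in>W. w \<bullet> v = F v)" "w' \<in> W \<and> (\<forall>v\<in>W. w' \<bullet> v = F v)" for w w'
  proof -
    have "w - w' \<in> W" using that sub by (auto intro: subspace_diff)
    then have "(w - w') \<bullet> (w - w') = 0" using that by (simp add: inner_diff_left)
    then show ?thesis by simp
  qed
  ultimately have "\<exists>!w. w \<in> W \<and> (\<forall>v\<in>W. w \<bullet> v = F v)" by blast
  from theI'[OF this] show ?thesis using v by (simp add: riesz_def)
qed

lemma A_op_inner:
  assumes "open \<Omega>" "fin_dim_subspace V\<^sub>h" "V\<^sub>h \<subseteq> velocity_space \<Omega>" "v \<in> V\<^sub>h"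
  shows "A_op \<Omega> V\<^sub>h u \<bullet> v = grad \<Omega> u \<bullet> grad \<Omega> v"
  unfolding A_op_def using assms
  by (intro riesz_inner[where F="\<lambda>v. grad \<Omega> u \<bullet> grad \<Omega> v"])
     (auto simp: grad_lincomb subset_iff inner_add_right)

lemma B'_op_inner:
  assumes "open \<Omega>" "fin_dim_subspace V\<^sub>h" "V\<^sub>h \<subseteq> velocity_space \<Omega>" "v \<in> V\<^sub>h"
  shows "B'_op \<Omega> V\<^sub>h q \<bullet> v = - (divergence \<Omega> v \<bullet> q)"
  unfolding B'_op_def using assms
  by (intro riesz_inner[where F="\<lambda>v. - (divergence \<Omega> v \<bullet> q)"])
     (auto simp: divergence_lincomb subset_iff inner_add_left)

lemma subspace_div_free:
  assumes \<Omega>: "open \<Omega>" and V: "subspace V\<^sub>h" "V\<^sub>h \<subseteq> velocity_space \<Omega>"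
  shows "subspace (div_free \<Omega> V\<^sub>h Q\<^sub>h)"
proof -
  have "a *\<^sub>R u + b *\<^sub>R v \<in> div_free \<Omega> V\<^sub>h Q\<^sub>h"
    if uv: "u \<in> div_free \<Omega> V\<^sub>h Q\<^sub>h" "v \<in> div_free \<Omega> V\<^sub>h Q\<^sub>h" for u v a b
  proof -
    have "u \<in> V\<^sub>h" "v \<in> V\<^sub>h" using uv by (auto simp: div_free_def)
    then have "divergence \<Omega> (a *\<^sub>R u + b *\<^sub>R v) = a *\<^sub>R divergence \<Omega> u + b *\<^sub>R divergence \<Omega> v"
      using V by (intro divergence_lincomb \<Omega>) auto
    then show ?thesis using uv V(1)
      by (auto simp: div_free_def inner_add_left intro: subspace_add subspace_scale)
  qed
  note lin = this
  have "divergence \<Omega> 0 = 0"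
    using divergence_lincomb[OF \<Omega>, of 0 0 0 0] V subspace_0[OF V(1)] by auto
  then have "0 \<in> div_free \<Omega> V\<^sub>h Q\<^sub>h"
    using subspace_0[OF V(1)] by (simp add: div_free_def)
  then show ?thesis
    using lin[of _ _ 1 1] lin[of _ _ _ 0] by (intro subspaceI) auto
qed

text \<open>
  The quotient in the inf-sup condition would be identically zero for such a \<open>q\<close>, or its supremum
  would be \<open>-\<infinity>\<close> if \<open>V\<^sub>h\<close> is trivial; neither is bounded below by \<open>\<beta> > 0\<close>.
\<close>

lemma inf_sup_imp_zero:
  assumes inf_sup: "inf_sup_condition \<Omega> \<beta> V\<^sub>h Q\<^sub>h" and q: "q \<in> Q\<^sub>h"
    and orth: "\<And>v. v \<in> V\<^sub>h \<Longrightarrow> divergence \<Omega> v \<bullet> q = 0"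
  shows "q = 0"
proof (rule ccontr)
  assume "q \<noteq> 0"
  then have "ereal \<beta> \<le> (SUP v\<in>V\<^sub>h - {0}. ereal (- (divergence \<Omega> v \<bullet> q) / (H1_norm_vec \<Omega> v * norm q)))"
    using inf_sup q unfolding inf_sup_condition_def by (auto elim!: order_trans intro!: INF_lower)
  also have "\<dots> \<le> 0" using orth by (intro SUP_least) auto
  finally show False using inf_sup by (simp add: inf_sup_condition_def)
qed

section \<open>Polynomials in time\<close>

lemma poly_space_1E:
  assumes "w \<in> poly_space 1 J W"
  obtains x y where "x \<in> W" "y \<in> W" "\<And>s. s \<in> J \<Longrightarrow> w s = x + s *\<^sub>R y"
proof -
  obtain c where c: "\<forall>i\<le>1. c i \<in> W" and w: "\<forall>s\<in>J. w s = (\<Sum>i\<le>1. s ^ i *\<^sub>R c i)"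
    using assms unfolding poly_space_def by blast
  show thesis by (rule that[of "c 0" "c 1"]) (simp_all add: c w)
qed

text \<open>
  The one-sided conventions in \<open>time_deriv\<close> agree with formal differentiation: at \<open>b\<close> it is a
  one-sided derivative, and at \<open>a\<close> a limit of derivatives, which does not see the value of \<open>w\<close>
  at \<open>a\<close>.
\<close>

lemma time_deriv_quadratic:
  fixes w :: "real \<Rightarrow> 'b::real_normed_vector"
  assumes ab: "a < b" and w: "\<And>s. s \<in> {a<..b} \<Longrightarrow> w s = x + s *\<^sub>R y + s\<^sup>2 *\<^sub>R z"
    and s: "s \<in> {a..b}"
  shows "time_deriv a b w s = y + (2 * s) *\<^sub>R z"
proof -
  have vd: "vector_derivative w (at r within {a<..b}) = y + (2 * r) *\<^sub>R z" if r: "r \<in> {a<..b}" for r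
  proof (rule vector_derivative_within)
    have "r islimpt {a<..<r}" using r by (simp add: islimpt_greaterThanLessThan2)
    then have "r islimpt {a<..b}" by (rule islimpt_subset) (use r in auto)
    then show "at r within {a<..b} \<noteq> bot" by (simp add: trivial_limit_within)
    have "((\<lambda>s. x + s *\<^sub>R y + s\<^sup>2 *\<^sub>R z) has_vector_derivative y + (2 * r) *\<^sub>R z) (at r within {a<..b})"
      by (auto intro!: derivative_eq_intros)
    then show "(w has_vector_derivative y + (2 * r) *\<^sub>R z) (at r within {a<..b})"
      by (rule has_vector_derivative_transform[rotated 2]) (use r w in auto)
  qed
  show ?thesis
  proof (cases "s = a")
    case False
    with s vd show ?thesis by (simp add: time_deriv_def)
  next
    case True
    have "((\<lambda>r. y + (2 * r) *\<^sub>R z) \<longlongrightarrow> y + (2 * a) *\<^sub>R z) (at_right a)" by (intro tendsto_intros)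
    moreover have "\<forall>\<^sub>F r in at_right a. y + (2 * r) *\<^sub>R z = vector_derivative w (at r within {a<..b})"
      using eventually_at_right_real[OF ab] by eventually_elim (simp add: vd)
    ultimately have "((\<lambda>r. vector_derivative w (at r within {a<..b})) \<longlongrightarrow> y + (2 * a) *\<^sub>R z) (at_right a)"
      by (rule Lim_transform_eventually)
    from tendsto_Lim[OF _ this] True show ?thesis by (simp add: time_deriv_def)
  qed
qed

lemma right_limit_eq:
  fixes w :: "real \<Rightarrow> 'b::t2_space"
  assumes ab: "a < b" and w: "\<And>s. s \<in> {a<..b} \<Longrightarrow> w s = g s"
    and lim: "(w \<longlongrightarrow> w a) (at_right a)" and g: "isCont g a"
  shows "w a = g a"
proof -
  have "(g \<longlongrightarrow> g a) (at_right a)" using g by (simp add: isCont_def filterlim_at_split)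
  moreover have "\<forall>\<^sub>F r in at_right a. g r = w r"
    using eventually_at_right_real[OF ab] by eventually_elim (simp add: w)
  ultimately have "(w \<longlongrightarrow> g a) (at_right a)" by (rule Lim_transform_eventually)
  with lim show ?thesis by (intro tendsto_unique[of "at_right a"]) auto
qed

lemma deriv_theta: "deriv (theta \<alpha> a b) s = \<alpha> * (2 * s - a - b)"
  unfolding theta_def[abs_def]
  by (rule DERIV_imp_deriv) (auto intro!: derivative_eq_intros simp: algebra_simps)

text \<open>
  The trapezoidal rule is exact on affine integrands, and the Galerkin residual tested with a fixed
  element is one.
\<close>

lemma integral_affine:
  assumes "a < (b::real)"
  shows "integral {a<..b} (\<lambda>s. k + s * l) = (b - a) / 2 * ((k + a * l) + (k + b * l))"
proof -
  have "((\<lambda>s. k + s * l) has_integral (k * b + b\<^sup>2 / 2 * l) - (k * a + a\<^sup>2 / 2 * l)) {a..b}"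
    using assms
    by (intro fundamental_theorem_of_calculus)
       (auto intro!: derivative_eq_intros simp flip: has_real_derivative_iff_has_vector_derivative)
  moreover have "negligible {s \<in> {a..b} - {a<..b}. k + s * l \<noteq> 0}"
    by (rule negligible_subset[of "{a}"]) auto
  moreover have "negligible {s \<in> {a<..b} - {a..b}. k + s * l \<noteq> 0}"
    by (rule negligible_subset[of "{}"]) auto
  ultimately have "((\<lambda>s. k + s * l) has_integral (k * b + b\<^sup>2 / 2 * l) - (k * a + a\<^sup>2 / 2 * l)) {a<..b}"
    by (simp only: has_integral_spike_set_eq[of "{a..b}" "{a<..b}"])
  then have "integral {a<..b} (\<lambda>s. k + s * l) = (k * b + b\<^sup>2 / 2 * l) - (k * a + a\<^sup>2 / 2 * l)"
    by (rule integral_unique)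
  also have "\<dots> = (b - a) / 2 * ((k + a * l) + (k + b * l))"
    by (simp add: field_simps power2_eq_square)
  finally show ?thesis .
qed

section \<open>Collocation at the nodes\<close>

text \<open>
  The post-processed pair collocates the equation at the left endpoint by construction; here it is
  shown to do so at the right endpoint. Tested with \<open>v\<close>, the Galerkin residual is \<open>k + s l\<close>,
  and exactness of the trapezoidal rule turns the Galerkin equation into
  \<open>(k + a l) + (k + b l) = \<langle>f(a) + f(b), v\<rangle>\<close>. The post-processing adds
  \<open>\<langle>c + B' d, v\<rangle>\<close> at \<open>a\<close> and subtracts it at \<open>b\<close>, so the equation at \<open>a\<close> entails
  the one at \<open>b\<close>.
\<close>

lemma post_processed_collocation_right:
  fixes \<Omega> :: "(real^'d::finite) set"
  assumes \<Omega>: "open \<Omega>" and V: "fin_dim_subspace V\<^sub>h" "V\<^sub>h \<subseteq> velocity_space \<Omega>" and ab: "a < b"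
    and u: "u \<in> poly_space 1 {a<..b} V\<^sub>h" and p: "p \<in> poly_space 1 {a<..b} Q\<^sub>h"
    and u_right: "(u \<longlongrightarrow> u a) (at_right a)"
    and galerkin: "\<forall>v\<in>V\<^sub>h. integral {a<..b}
             (\<lambda>s. (time_deriv a b u s + A_op \<Omega> V\<^sub>h (u s) + B'_op \<Omega> V\<^sub>h (p s)) \<bullet> v)
           = (b - a) / 2 * ((f a + f b) \<bullet> v)"
    and post: "post_processed \<Omega> V\<^sub>h Q\<^sub>h a b f u p w r"
  shows "w a = u a" "w b = u b"
    and "\<And>v. v \<in> V\<^sub>h \<Longrightarrow> (time_deriv a b w b + A_op \<Omega> V\<^sub>h (w b) + B'_op \<Omega> V\<^sub>h (r b)) \<bullet> v = f b \<bullet> v"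
proof -
  obtain x0 x1 where x: "x0 \<in> V\<^sub>h" "x1 \<in> V\<^sub>h" and us: "\<And>s. s \<in> {a<..b} \<Longrightarrow> u s = x0 + s *\<^sub>R x1"
    using poly_space_1E[OF u] by blast
  obtain y0 y1 where ps: "\<And>s. s \<in> {a<..b} \<Longrightarrow> p s = y0 + s *\<^sub>R y1"
    using poly_space_1E[OF p] by blast
  obtain \<alpha> c d where c_div: "c \<in> div_free \<Omega> V\<^sub>h Q\<^sub>h" and d\<theta>: "deriv (theta \<alpha> a b) a = 1"
    and ws': "\<forall>s\<in>{a<..b}. w s = u s + theta \<alpha> a b s *\<^sub>R c"
    and rs': "\<forall>s\<in>{a<..b}. r s = p s + deriv (theta \<alpha> a b) s *\<^sub>R d"
    using post unfolding post_processed_def by blast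
  have c: "c \<in> V\<^sub>h" using c_div by (simp add: div_free_def)
  have \<alpha>: "\<alpha> * (a - b) = 1" using d\<theta> by (simp add: deriv_theta)
  have ws: "w s = u s + theta \<alpha> a b s *\<^sub>R c"
    and rs: "r s = p s + deriv (theta \<alpha> a b) s *\<^sub>R d" if "s \<in> {a<..b}" for s
    using ws' rs' that by auto
  have w_right: "(w \<longlongrightarrow> w a) (at_right a)" and r_right: "(r \<longlongrightarrow> r a) (at_right a)"
    and colloc: "\<And>v. v \<in> V\<^sub>h \<Longrightarrow> (time_deriv a b w a + A_op \<Omega> V\<^sub>h (w a) + B'_op \<Omega> V\<^sub>h (r a)) \<bullet> v = f a \<bullet> v"
    using post by (auto simp: post_processed_def)
  have b_mem: "b \<in> {a<..b}" using ab by simp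
  have ua: "u a = x0 + a *\<^sub>R x1"
    by (rule right_limit_eq[OF ab us u_right]) (auto intro!: continuous_intros)
  have "w a = x0 + a *\<^sub>R x1 + theta \<alpha> a b a *\<^sub>R c"
    by (rule right_limit_eq[OF ab _ w_right, of "\<lambda>s. x0 + s *\<^sub>R x1 + theta \<alpha> a b s *\<^sub>R c"])
       (auto simp: ws us theta_def intro!: continuous_intros)
  then show wa: "w a = u a" by (simp add: theta_def ua)
  show wb: "w b = u b" using ws[OF b_mem] by (simp add: theta_def)
  have "r a = y0 + a *\<^sub>R y1 + deriv (theta \<alpha> a b) a *\<^sub>R d"
    by (rule right_limit_eq[OF ab _ r_right, of "\<lambda>s. y0 + s *\<^sub>R y1 + deriv (theta \<alpha> a b) s *\<^sub>R d"])
       (auto simp: rs ps deriv_theta intro!: continuous_intros)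
  then have ra: "r a = y0 + a *\<^sub>R y1 + d" using \<alpha> by (simp add: deriv_theta)
  have \<alpha>': "\<alpha> * (b - a) = - 1" using \<alpha> by (simp add: algebra_simps)
  have rb: "r b = y0 + b *\<^sub>R y1 - d" using rs[OF b_mem] ps[OF b_mem] \<alpha>' by (simp add: deriv_theta)
  have wquad: "w s = (x0 + (\<alpha> * a * b) *\<^sub>R c) + s *\<^sub>R (x1 - (\<alpha> * (a + b)) *\<^sub>R c) + s\<^sup>2 *\<^sub>R (\<alpha> *\<^sub>R c)"
    if "s \<in> {a<..b}" for s
    using ws[OF that] us[OF that] by (simp add: theta_def algebra_simps power2_eq_square)
  have dw: "time_deriv a b w s = x1 + (\<alpha> * (2 * s - a - b)) *\<^sub>R c" if "s \<in> {a..b}" for s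
    using time_deriv_quadratic[OF ab wquad that] by (simp add: algebra_simps)
  have dwa: "time_deriv a b w a = x1 + c" using dw[of a] ab \<alpha> by simp
  \<comment> \<open>The sign change against the left endpoint is \<open>\<vartheta>'(b) = -\<vartheta>'(a)\<close>.\<close>
  have dwb: "time_deriv a b w b = x1 - c" using dw[of b] ab \<alpha>' by simp
  have du: "time_deriv a b u s = x1" if "s \<in> {a<..b}" for s
    using time_deriv_quadratic[OF ab, of u x0 x1 0 s] us that by simp
  fix v assume v: "v \<in> V\<^sub>h"
  note A = A_op_inner[OF \<Omega> V v] and B = B'_op_inner[OF \<Omega> V v]
  define k where "k = x1 \<bullet> v + grad \<Omega> x0 \<bullet> grad \<Omega> v - divergence \<Omega> v \<bullet> y0"
  define l where "l = grad \<Omega> x1 \<bullet> grad \<Omega> v - divergence \<Omega> v \<bullet> y1"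
  have gr: "grad \<Omega> (x0 + s *\<^sub>R x1) = grad \<Omega> x0 + s *\<^sub>R grad \<Omega> x1" for s
    using grad_lincomb[OF \<Omega>, of x0 x1 1 s] x V(2) by auto
  have "integral {a<..b} (\<lambda>s. (time_deriv a b u s + A_op \<Omega> V\<^sub>h (u s) + B'_op \<Omega> V\<^sub>h (p s)) \<bullet> v)
      = integral {a<..b} (\<lambda>s. k + s * l)"
    by (rule Henstock_Kurzweil_Integration.integral_cong)
       (simp add: us ps du inner_add_left A B gr k_def l_def inner_add_right algebra_simps)
  then have "(b - a) / 2 * ((k + a * l) + (k + b * l)) = (b - a) / 2 * ((f a + f b) \<bullet> v)"
    by (simp only: bspec[OF galerkin v] integral_affine[OF ab])
  then have trap: "(k + a * l) + (k + b * l) = f a \<bullet> v + f b \<bullet> v"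
    using ab by (simp only: mult_left_cancel[of "(b - a) / 2"] inner_add_left) simp
  have "k + a * l + (c \<bullet> v - divergence \<Omega> v \<bullet> d) = f a \<bullet> v"
    using colloc[OF v]
    by (simp add: wa ua ra dwa inner_add_left A B gr k_def l_def inner_add_right algebra_simps)
  with trap have "k + b * l - (c \<bullet> v - divergence \<Omega> v \<bullet> d) = f b \<bullet> v" by simp
  then show "(time_deriv a b w b + A_op \<Omega> V\<^sub>h (w b) + B'_op \<Omega> V\<^sub>h (r b)) \<bullet> v = f b \<bullet> v"
    by (simp add: wb us[OF b_mem] rb dwb inner_add_left inner_diff_left inner_diff_right A B gr
        k_def l_def inner_add_right algebra_simps)
qed

text \<open>
  With \<open>W\<close> the discretely divergence free functions, this makes the jump of the time derivative
  an admissible test function that eliminates the pressure.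
\<close>

lemma time_deriv_in_coefficient_space:
  assumes W: "subspace W" and ab: "a < b" and s: "s \<in> {a..b}" and w: "w \<in> poly_space 2 {a..b} W"
  shows "time_deriv a b w s \<in> W"
proof -
  obtain c where c: "\<forall>i\<le>2. c i \<in> W" and ws: "\<forall>s\<in>{a..b}. w s = (\<Sum>i\<le>2. s ^ i *\<^sub>R c i)"
    using w unfolding poly_space_def by blast
  have "time_deriv a b w s = c 1 + (2 * s) *\<^sub>R c 2"
    by (rule time_deriv_quadratic[OF ab _ s, where x="c 0"]) (simp add: ws numeral_2_eq_2)
  then show ?thesis using c W by (auto intro!: subspace_add subspace_scale)
qed

theorem lemma4p4:
  fixes \<Omega> :: "(real^'d::finite) set"
    and T \<beta> :: real
    and N :: nat
    and t :: "nat \<Rightarrow> real"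
    and V\<^sub>h :: "(real^'d, real^'d) L2 set"
    and Q\<^sub>h :: "(real^'d, real) L2 set"
    and f u :: "real \<Rightarrow> (real^'d, real^'d) L2"
    and p :: "real \<Rightarrow> (real^'d, real) L2"
    and u\<^sub>0 :: "(real^'d, real^'d) L2"
    and u_post :: "nat \<Rightarrow> real \<Rightarrow> (real^'d, real^'d) L2"
    and p_post :: "nat \<Rightarrow> real \<Rightarrow> (real^'d, real) L2"
  assumes dim: "CARD('d) \<in> {2, 3}"
    and domain: "open \<Omega>" "connected \<Omega>" "bounded \<Omega>" "\<Omega> \<noteq> {}"
    and time: "0 < T" "time_mesh T N t"
    and V_h: "fin_dim_subspace V\<^sub>h" "V\<^sub>h \<subseteq> velocity_space \<Omega>"
    and Q_h: "fin_dim_subspace Q\<^sub>h" "Q\<^sub>h \<subseteq> pressure_space \<Omega>"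
    and inf_sup: "inf_sup_condition \<Omega> \<beta> V\<^sub>h Q\<^sub>h"
    and force: "continuous_on {0..T} f" "\<forall>s\<in>{0..T}. f s \<in> L2_on \<Omega>"
    and scheme: "galerkin_solution \<Omega> V\<^sub>h Q\<^sub>h N t f u\<^sub>0 u p"
    and post_spaces: "\<forall>n\<in>{1..N}.
          u_post n \<in> poly_space 2 {t (n - 1)..t n} (div_free \<Omega> V\<^sub>h Q\<^sub>h) \<and>
          p_post n \<in> poly_space 1 {t (n - 1)..t n} Q\<^sub>h"
    and post: "\<forall>n\<in>{1..N}.
          post_processed \<Omega> V\<^sub>h Q\<^sub>h (t (n - 1)) (t n) f u p (u_post n) (p_post n)"
  shows "\<forall>n\<in>{1..<N}.
      time_deriv (t (n - 1)) (t n) (u_post n) (t n)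
        = time_deriv (t n) (t (n + 1)) (u_post (n + 1)) (t n) \<and>
      p_post n (t n) = p_post (n + 1) (t n)"
proof
  fix n assume "n \<in> {1..<N}"
  then have n: "n \<in> {1..N}" and n': "n + 1 \<in> {1..N}" by auto
  define a b c where "a = t (n - 1)" and "b = t n" and "c = t (n + 1)"
  have ab: "a < b" and bc: "b < c"
    using time(2) bspec[OF _ n] bspec[OF _ n', of "\<lambda>n. t (n - 1) < t n"]
    by (auto simp: time_mesh_def a_def b_def c_def)
  have V: "subspace V\<^sub>h" and Q: "subspace Q\<^sub>h" using V_h Q_h by (auto simp: fin_dim_subspace_def)
  note D = subspace_div_free[OF domain(1) V V_h(2), of Q\<^sub>h]
  have left: "u \<in> poly_space 1 {a<..b} V\<^sub>h" "p \<in> poly_space 1 {a<..b} Q\<^sub>h" "(u \<longlongrightarrow> u a) (at_right a)"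
    "\<forall>v\<in>V\<^sub>h. integral {a<..b}
       (\<lambda>s. (time_deriv a b u s + A_op \<Omega> V\<^sub>h (u s) + B'_op \<Omega> V\<^sub>h (p s)) \<bullet> v) = (b - a) / 2 * ((f a + f b) \<bullet> v)"
    using scheme n by (auto simp: galerkin_solution_def Let_def a_def b_def)
  have right: "u \<in> poly_space 1 {b<..c} V\<^sub>h" "p \<in> poly_space 1 {b<..c} Q\<^sub>h" "(u \<longlongrightarrow> u b) (at_right b)"
    "\<forall>v\<in>V\<^sub>h. integral {b<..c}
       (\<lambda>s. (time_deriv b c u s + A_op \<Omega> V\<^sub>h (u s) + B'_op \<Omega> V\<^sub>h (p s)) \<bullet> v) = (c - b) / 2 * ((f b + f c) \<bullet> v)"
    using bspec[OF conjunct2[OF conjunct2[OF scheme[unfolded galerkin_solution_def]]] n']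
    by (auto simp: Let_def b_def c_def)
  have post_left: "post_processed \<Omega> V\<^sub>h Q\<^sub>h a b f u p (u_post n) (p_post n)"
    using post n by (simp add: a_def b_def)
  have post_right: "post_processed \<Omega> V\<^sub>h Q\<^sub>h b c f u p (u_post (n + 1)) (p_post (n + 1))"
    using bspec[OF post n'] by (simp add: b_def c_def)
  note L = post_processed_collocation_right[OF domain(1) V_h ab left post_left]
  note R = post_processed_collocation_right[OF domain(1) V_h bc right post_right]
  define e where "e = time_deriv a b (u_post n) b - time_deriv b c (u_post (n + 1)) b"
  define q where "q = p_post n b - p_post (n + 1) b"
  have e_div: "e \<in> div_free \<Omega> V\<^sub>h Q\<^sub>h"
    unfolding e_def
  proof (rule subspace_diff[OF D])
    show "time_deriv a b (u_post n) b \<in> div_free \<Omega> V\<^sub>h Q\<^sub>h"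
      using ab post_spaces n by (intro time_deriv_in_coefficient_space[OF D ab]) (auto simp: a_def b_def)
    show "time_deriv b c (u_post (n + 1)) b \<in> div_free \<Omega> V\<^sub>h Q\<^sub>h"
      using bc bspec[OF post_spaces n']
      by (intro time_deriv_in_coefficient_space[OF D bc]) (auto simp: b_def c_def)
  qed
  have poly_val: "r s \<in> Q\<^sub>h" if "r \<in> poly_space 1 J Q\<^sub>h" "s \<in> J" for r s J
    using that Q by (auto simp: poly_space_def intro!: subspace_add subspace_scale)
  have q_mem: "q \<in> Q\<^sub>h"
    unfolding q_def using bspec[OF post_spaces n] bspec[OF post_spaces n'] ab bc
    by (intro subspace_diff[OF Q]; intro poly_val) (auto simp: a_def b_def c_def)
  have diff: "e \<bullet> v = divergence \<Omega> v \<bullet> q" if v: "v \<in> V\<^sub>h" for v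
  proof -
    have "(time_deriv b c (u_post (n + 1)) b + A_op \<Omega> V\<^sub>h (u_post (n + 1) b)
        + B'_op \<Omega> V\<^sub>h (p_post (n + 1) b)) \<bullet> v = f b \<bullet> v"
      using post_right v by (simp add: post_processed_def)
    with L(3)[OF v] show ?thesis
      by (simp add: L(2) R(1)[simplified] e_def q_def inner_add_left inner_diff_left inner_diff_right
          B'_op_inner[OF domain(1) V_h v])
  qed
  \<comment> \<open>Testing with \<open>e\<close> itself removes the pressure jump, as \<open>e\<close> is discretely divergence free.\<close>
  have "e \<bullet> e = 0" using diff[of e] e_div q_mem by (auto simp: div_free_def)
  then have e0: "e = 0" by simp
  have "divergence \<Omega> v \<bullet> q = 0" if "v \<in> V\<^sub>h" for v using diff[OF that] e0 by simp
  then have "q = 0" by (rule inf_sup_imp_zero[OF inf_sup q_mem])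
  with e0 show "time_deriv (t (n - 1)) (t n) (u_post n) (t n)
        = time_deriv (t n) (t (n + 1)) (u_post (n + 1)) (t n) \<and>
      p_post n (t n) = p_post (n + 1) (t n)"
    by (simp add: e_def q_def a_def b_def c_def)
qed

end
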